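(* Let $n\ge2$ and let $X_n=\{p_n(z;x,y)=0\}\subset\mathbb{C}P^2$. Under projective duality the curve $X_n$ is sent to $$X_n^\vee=\{(uvw)^{n-1}p_{n-1}(1/w;1/u,1/v)=0\}\subset(\mathbb{C}P^2)^\ast.$$ The composition of the duality $X_n\mapsto X_n^\vee$ with the subsequent Möbius transformation $(u,v,w)\mapsto(1/u,1/v,1/w)$ defines the shift operation $\mathbb{M}_n(\mathbb{C}P^1)\mapsto\mathbb{M}_{n-1}(\mathbb{C}P^1)$ in the family of algebraic $n$-valued monoids: it takes the polynomial $p_n$ defining the multiplication of $\mathbb{M}_n(\mathbb{C}P^1)$ to the polynomial $p_{n-1}$ defining the multiplication of $\mathbb{M}_{n-1}(\mathbb{C}P^1)$.
   Context: For $k\ge1$ and $\varepsilon=e^{2\pi i/k}$, $p_k(z;x,y)=\prod_{r,s=1}^k(\sqrt[k]{z}+\varepsilon^r\sqrt[k]{x}+\varepsilon^s\sqrt[k]{y})$ (fixed branches of the roots), a symmetric homogeneous polynomial of degree $k$ in $x,y,z$ with integer coefficients. The dual coordinates $(u:v:w)$ on $(\mathbb{C}P^2)^\ast$ represent the line $ux+vy+wz=0$; the projectively dual curve $X^\vee$ is the closure of the set of lines tangent to $X$ at its smooth points. $\mathbb{M}_k(\mathbb{C}P^1)$ is the algebraic $k$-valued monoid on $\mathbb{C}P^1=\mathbb{C}\cup\{\infty\}$ with neutral element $0$ in which $(x_1:x_0)\ast(y_1:y_0)$ is the multiset of zeros (with multiplicity) in $(z_1:z_0)$ of $(x_0y_0z_0)^kp_k(z_1/z_0;(-1)^kx_1/x_0,(-1)^ky_1/y_0)$,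 defined unless both arguments are $\infty=(1:0)$. *)

theory Defs
  imports "HOL-Analysis.Analysis"
begin

section \<open>Complex projective spaces\<close>

definition proportional :: "complex ^ 'n \<Rightarrow> complex ^ 'n \<Rightarrow> bool" where
  "proportional v w \<longleftrightarrow> v \<noteq> 0 \<and> (\<exists>c. c \<noteq> 0 \<and> w = c *s v)"

text \<open>The points of \<open>'n proj\<close> are the lines through the origin of \<open>complex ^ 'n\<close>;
  thus \<open>2 proj\<close> is the projective line and \<open>3 proj\<close> the projective plane. The abstraction
  map sends a nonzero vector to the point with these homogeneous coordinates (its value at the
  zero vector is irrelevant).\<close>

quotient_type (overloaded) 'n proj = "complex ^ ('n :: finite)" / partial: proportional
  morphisms coords point
proof (rule part_equivpI)
  have "axis undefined 1 \<noteq> (0 :: complex ^ 'n)"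
    by (simp add: axis_eq_0_iff)
  then have "proportional (axis undefined 1) (axis undefined 1 :: complex ^ 'n)"
    unfolding proportional_def by (metis vector_smult_lid one_neq_zero)
  then show "\<exists>x :: complex ^ 'n. proportional x x" by blast
  show "symp (proportional :: complex ^ 'n \<Rightarrow> _)"
  proof (rule sympI)
    fix v w :: "complex ^ 'n"
    assume "proportional v w"
    then obtain c where "v \<noteq> 0" "c \<noteq> 0" "w = c *s v" unfolding proportional_def by blast
    then have "w \<noteq> 0" "inverse c \<noteq> 0" "v = inverse c *s w"
      by (auto simp: vector_smult_assoc vector_mul_eq_0)
    then show "proportional w v" unfolding proportional_def by blast
  qed
  show "transp (proportional :: complex ^ 'n \<Rightarrow> _)"
    unfolding transp_def proportional_def
    by (metis vector_smult_assoc mult_eq_0_iff)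
qed

abbreviation infinity_pt :: "2 proj" where
  "infinity_pt \<equiv> point (vector [1, 0])"

abbreviation zero_pt :: "2 proj" where
  "zero_pt \<equiv> point (vector [0, 1])"

section \<open>Ternary forms and plane curves\<close>

text \<open>Polynomials over the infinite field of complex numbers are identified with the
  polynomial functions they induce.\<close>

definition ternary_form :: "nat \<Rightarrow> (nat \<Rightarrow> nat \<Rightarrow> nat \<Rightarrow> complex) \<Rightarrow> complex ^ 3 \<Rightarrow> complex" where
  "ternary_form d c v =
     (\<Sum>(i, j, l) \<in> {(i, j, l). i + j + l = d}. c i j l * (v $ 1) ^ i * (v $ 2) ^ j * (v $ 3) ^ l)"

definition is_form :: "nat \<Rightarrow> (complex ^ 3 \<Rightarrow> complex) \<Rightarrow> bool" where
  "is_form d F \<longleftrightarrow> (\<exists>c. F = ternary_form d c)"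

text \<open>The coefficients of a form of degree \<open>d\<close> with index sum \<open>d\<close> are unique.\<close>

definition form_coeff :: "nat \<Rightarrow> (complex ^ 3 \<Rightarrow> complex) \<Rightarrow> nat \<Rightarrow> nat \<Rightarrow> nat \<Rightarrow> complex" where
  "form_coeff d F = (SOME c. F = ternary_form d c)"

definition zero_locus :: "(complex ^ 3 \<Rightarrow> complex) \<Rightarrow> 3 proj set" where
  "zero_locus F = {point v | v. v \<noteq> 0 \<and> F v = 0}"

definition vanishes_on :: "(complex ^ 3 \<Rightarrow> complex) \<Rightarrow> 3 proj set \<Rightarrow> bool" where
  "vanishes_on G S \<longleftrightarrow> (\<forall>v. v \<noteq> 0 \<and> point v \<in> S \<longrightarrow> G v = 0)"

definition zariski_closure :: "3 proj set \<Rightarrow> 3 proj set" where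
  "zariski_closure S =
     {point v | v. v \<noteq> 0 \<and> (\<forall>d G. is_form d G \<and> vanishes_on G S \<longrightarrow> G v = 0)}"

text \<open>\<open>F\<close> is the reduced equation of the curve \<open>X\<close>: it cuts out \<open>X\<close> and generates the homogeneous
  vanishing ideal of \<open>X\<close>. This determines \<open>F\<close> up to a nonzero constant.\<close>

definition defining_form :: "nat \<Rightarrow> (complex ^ 3 \<Rightarrow> complex) \<Rightarrow> 3 proj set \<Rightarrow> bool" where
  "defining_form d F X \<longleftrightarrow> is_form d F \<and> X = zero_locus F \<and>
     (\<forall>e G. is_form e G \<and> vanishes_on G X \<longrightarrow> (\<exists>h H. is_form h H \<and> (\<forall>v. G v = F v * H v)))"

section \<open>Projective duality\<close>

definition gradient :: "(complex ^ 3 \<Rightarrow> complex) \<Rightarrow> complex ^ 3 \<Rightarrow> complex ^ 3" where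
  "gradient G v = (\<chi> i. deriv (\<lambda>t. G (v + t *s axis i 1)) 0)"

text \<open>The affine cone over the projective tangent space of \<open>X\<close> at the point \<open>v\<close>, cut out by the
  differentials of all forms vanishing on \<open>X\<close>.\<close>

definition tangent_space :: "3 proj set \<Rightarrow> complex ^ 3 \<Rightarrow> (complex ^ 3) set" where
  "tangent_space X v =
     {x. \<forall>d G. is_form d G \<and> vanishes_on G X \<longrightarrow> scalar_product (gradient G v) x = 0}"

text \<open>The point \<open>(u : v : w)\<close> of the dual plane represents the line \<open>u x + v y + w z = 0\<close>.\<close>

definition line_cone :: "complex ^ 3 \<Rightarrow> (complex ^ 3) set" where
  "line_cone l = {x. scalar_product l x = 0}"

text \<open>A point of a curve is smooth iff its projective tangent space has the dimension of the
  curve, that is, iff it is a line; this line is then the tangent line.\<close>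

definition tangent_line_at :: "3 proj set \<Rightarrow> complex ^ 3 \<Rightarrow> complex ^ 3 \<Rightarrow> bool" where
  "tangent_line_at X v l \<longleftrightarrow>
     v \<noteq> 0 \<and> point v \<in> X \<and> l \<noteq> 0 \<and> tangent_space X v = line_cone l"

definition dual_curve :: "3 proj set \<Rightarrow> 3 proj set" where
  "dual_curve X = zariski_closure {point l | l. \<exists>v. tangent_line_at X v l}"

text \<open>The transformation \<open>(u, v, w) \<mapsto> (1/u, 1/v, 1/w)\<close> is birational; the image of a curve is the
  closure of the image of its part with \<open>u v w \<noteq> 0\<close>.\<close>

definition moebius_image :: "3 proj set \<Rightarrow> 3 proj set" where
  "moebius_image Y = zariski_closure
     {point (vector [1 / u, 1 / v, 1 / w]) | u v w.
        u \<noteq> 0 \<and> v \<noteq> 0 \<and> w \<noteq> 0 \<and> point (vector [u, v, w]) \<in> Y}"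

section \<open>The polynomials \<open>p\<^sub>k\<close>\<close>

text \<open>The branch of the \<open>k\<close>-th root is the principal one, with \<open>0 powr (1 / k) = 0\<close>.\<close>

definition p_poly :: "nat \<Rightarrow> complex \<Rightarrow> complex \<Rightarrow> complex \<Rightarrow> complex" where
  "p_poly k z x y =
     (let \<epsilon> = exp (2 * of_real pi * \<i> / of_nat k);
          rt = (\<lambda>a :: complex. a powr (1 / of_nat k))
      in (\<Prod>r = 1..k. \<Prod>s = 1..k. (rt z + \<epsilon> ^ r * rt x + \<epsilon> ^ s * rt y)))"

definition p_form :: "nat \<Rightarrow> complex ^ 3 \<Rightarrow> complex" where
  "p_form k v = p_poly k (v $ 3) (v $ 1) (v $ 2)"

text \<open>The polynomial \<open>(x\<^sub>0 y\<^sub>0 z\<^sub>0)\<^sup>d F(x\<^sub>1/x\<^sub>0, y\<^sub>1/y\<^sub>0, z\<^sub>1/z\<^sub>0)\<close>, where \<open>F\<close> is a form of degree \<open>d\<close>. It is given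
  by coefficients, because it must also be evaluated where denominators vanish.\<close>

definition cleared :: "nat \<Rightarrow> (complex ^ 3 \<Rightarrow> complex) \<Rightarrow>
    complex ^ 2 \<Rightarrow> complex ^ 2 \<Rightarrow> complex ^ 2 \<Rightarrow> complex" where
  "cleared d F x y z = (\<Sum>(i, j, l) \<in> {(i, j, l). i + j + l = d}. form_coeff d F i j l *
     ((x $ 1) ^ i * (x $ 2) ^ (d - i)) * ((y $ 1) ^ j * (y $ 2) ^ (d - j)) *
     ((z $ 1) ^ l * (z $ 2) ^ (d - l)))"

lemma cleared_eq:
  assumes "is_form d F" "x $ 2 \<noteq> 0" "y $ 2 \<noteq> 0" "z $ 2 \<noteq> 0"
  shows "cleared d F x y z =
    (x $ 2 * y $ 2 * z $ 2) ^ d * F (vector [x $ 1 / x $ 2, y $ 1 / y $ 2, z $ 1 / z $ 2])"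
proof -
  have F: "F = ternary_form d (form_coeff d F)"
    using assms(1) unfolding is_form_def form_coeff_def by (rule someI_ex)
  have "F (vector [x $ 1 / x $ 2, y $ 1 / y $ 2, z $ 1 / z $ 2]) =
      ternary_form d (form_coeff d F) (vector [x $ 1 / x $ 2, y $ 1 / y $ 2, z $ 1 / z $ 2])"
    using F by metis
  moreover have "cleared d F x y z = (x $ 2 * y $ 2 * z $ 2) ^ d *
      ternary_form d (form_coeff d F) (vector [x $ 1 / x $ 2, y $ 1 / y $ 2, z $ 1 / z $ 2])"
    unfolding cleared_def ternary_form_def sum_distrib_left
    by (rule sum.cong) (use assms(2-4) in \<open>auto simp: power_mult_distrib power_divide power_add\<close>)
  ultimately show ?thesis by simp
qed

definition curve_X :: "nat \<Rightarrow> 3 proj set" where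
  "curve_X n = zero_locus (p_form n)"

text \<open>For a form \<open>F\<close> of degree \<open>d\<close>, the polynomial \<open>(u v w)\<^sup>d F(1/u, 1/v, 1/w)\<close>.\<close>

definition inverted_form :: "nat \<Rightarrow> (complex ^ 3 \<Rightarrow> complex) \<Rightarrow> complex ^ 3 \<Rightarrow> complex" where
  "inverted_form d F v =
     cleared d F (vector [1, v $ 1]) (vector [1, v $ 2]) (vector [1, v $ 3])"

section \<open>The multivalued monoids on the projective line\<close>

text \<open>The zeros, with multiplicity, of a nonzero binary form \<open>B\<close> of degree \<open>d\<close>: the finite ones
  are the roots of \<open>B(t, 1)\<close>, and infinity accounts for the drop of the degree of \<open>B(t, 1)\<close>.\<close>

definition binary_zeros :: "nat \<Rightarrow> (complex ^ 2 \<Rightarrow> complex) \<Rightarrow> 2 proj multiset" where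
  "binary_zeros d B =
     (let p = (THE p :: complex poly. \<forall>t. poly p t = B (vector [t, 1]))
      in image_mset (\<lambda>t. point (vector [t, 1])) (proots p)
         + replicate_mset (d - degree p) infinity_pt)"

record multivalued_monoid =
  valence :: nat
  neutral :: "2 proj"
  multiplication :: "2 proj \<Rightarrow> 2 proj \<Rightarrow> 2 proj multiset option"

text \<open>The structure whose multiplication is defined by the form \<open>F\<close> of degree \<open>k\<close>. The multiset of
  zeros does not depend on the coordinates chosen for the factors.\<close>

definition monoid_of_form :: "nat \<Rightarrow> (complex ^ 3 \<Rightarrow> complex) \<Rightarrow> multivalued_monoid" where
  "monoid_of_form k F = \<lparr>
     valence = k,
     neutral = zero_pt,
     multiplication = (\<lambda>P Q.
       if P = infinity_pt \<and> Q = infinity_pt then None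
       else let x = coords P; y = coords Q in
         Some (binary_zeros k
           (cleared k F (vector [(-1) ^ k * x $ 1, x $ 2]) (vector [(-1) ^ k * y $ 1, y $ 2]))))\<rparr>"

definition monoid_M :: "nat \<Rightarrow> multivalued_monoid" where
  "monoid_M k = monoid_of_form k (p_form k)"

text \<open>The effect on reduced equations of duality followed by the Moebius transformation.\<close>

definition form_shift ::
    "nat \<Rightarrow> (complex ^ 3 \<Rightarrow> complex) \<Rightarrow> nat \<Rightarrow> (complex ^ 3 \<Rightarrow> complex) \<Rightarrow> bool" where
  "form_shift d F e G \<longleftrightarrow>
     defining_form d F (zero_locus F) \<and>
     defining_form e G (moebius_image (dual_curve (zero_locus F)))"

definition monoid_shift :: "multivalued_monoid \<Rightarrow> multivalued_monoid \<Rightarrow> bool" where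
  "monoid_shift M M' \<longleftrightarrow> (\<exists>d F e G.
     M = monoid_of_form d F \<and> M' = monoid_of_form e G \<and> form_shift d F e G)"

end

theory Submission
  imports Defs
begin

text \<open>
  Everything rests on the parametrization of \<open>X\<^sub>n\<close>: the form \<open>p\<^sub>n(c\<^sup>n; a\<^sup>n, b\<^sup>n)\<close> is the product of all
  linear forms \<open>c + u a + w b\<close> with \<open>u\<close>, \<open>w\<close> running through the \<open>n\<close>-th roots of unity, so \<open>X\<^sub>n\<close> is the
  image of the line \<open>a + b + c = 0\<close> under \<open>(a, b, c) \<mapsto> (a\<^sup>n, b\<^sup>n, c\<^sup>n)\<close>. Differentiating this
  parametrization, a line \<open>(u : v : w)\<close> tangent to \<open>X\<^sub>n\<close> at such a point satisfies
  \<open>u a\<^bsup>n-1\<^esup> = v b\<^bsup>n-1\<^esup> = w c\<^bsup>n-1\<^esup>\<close>. If \<open>u v w \<noteq> 0\<close>, then \<open>(1/u, 1/v, 1/w)\<close> is proportional to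
  \<open>(a\<^bsup>n-1\<^esup>, b\<^bsup>n-1\<^esup>, c\<^bsup>n-1\<^esup>)\<close>, again with \<open>a + b + c = 0\<close>, and this is the parametrization of
  \<open>X\<^bsub>n-1\<^esub>\<close>. Conversely, at a generic point of the line all linear factors but one are nonzero, so the
  gradient of \<open>p\<^sub>n\<close> does not vanish and the tangent line exists; the remaining points are reached by
  passing to the closure (\<open>dual_curve_X\<close>, \<open>moebius_image_inverted_form\<close>).

  The Zariski closures call for an identity principle: forms have no zero divisors
  (\<open>form_mult_eq_0\<close>), so a form that vanishes wherever finitely many nonzero forms do not vanish is
  zero. That \<open>p\<^sub>n\<close> is a form at all follows from its invariance under multiplying \<open>a\<close>, \<open>b\<close> or \<open>c\<close> by
  an \<open>n\<close>-th root of unity (\<open>invariant_form_is_form_in_powers\<close>), and that it generates the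
  vanishing ideal of \<open>X\<^sub>n\<close> follows by dividing \<open>G(a\<^sup>n, b\<^sup>n, c\<^sup>n)\<close> by the linear factors one at a time
  and descending the quotient to a form in \<open>a\<^sup>n\<close>, \<open>b\<^sup>n\<close>, \<open>c\<^sup>n\<close> by the same invariance argument
  (\<open>defining_form_p_form\<close>).

  The shift is well defined on monoids because the multiplication determines the zeros of the form
  behind it (\<open>zeros_determined_by_monoid\<close>), because reduced equations are unique up to a nonzero
  constant (\<open>defining_form_unique\<close>), and because a constant factor does not affect the
  multiplication (\<open>monoid_of_form_scale\<close>).
\<close>

section \<open>Ternary forms\<close>

lemma finite_exponents: "finite {(i, j, l). i + j + l = (d :: nat)}"
  by (rule finite_subset[of _ "{..d} \<times> {..d} \<times> {..d}"]) auto

lemma is_formE: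
  assumes "is_form d F"
  obtains c where "F = ternary_form d c"
  using assms unfolding is_form_def by blast

lemma is_form_zero: "is_form d (\<lambda>v. 0)"
  unfolding is_form_def ternary_form_def by (rule exI[of _ "\<lambda>i j l. 0"]) (auto simp: fun_eq_iff intro!: sum.neutral)

lemma is_form_monomial:
  assumes "i + j + l = d"
  shows "is_form d (\<lambda>v. k * (v $ 1) ^ i * (v $ 2) ^ j * (v $ 3) ^ l)"
proof -
  let ?c = "\<lambda>i' j' l'. if (i', j', l') = (i, j, l) then k else 0"
  have "ternary_form d ?c v = k * (v $ 1) ^ i * (v $ 2) ^ j * (v $ 3) ^ l" for v
  proof -
    have "ternary_form d ?c v = (\<Sum>m \<in> {(i, j, l). i + j + l = d}.
        if m = (i, j, l) then k * (v $ 1) ^ i * (v $ 2) ^ j * (v $ 3) ^ l else 0)"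
      unfolding ternary_form_def by (rule sum.cong) (auto split: if_splits)
    then show ?thesis using assms by (simp add: finite_exponents)
  qed
  then show ?thesis unfolding is_form_def by (intro exI[of _ ?c]) (auto simp: fun_eq_iff)
qed

lemma is_form_add:
  assumes "is_form d F" "is_form d G"
  shows "is_form d (\<lambda>v. F v + G v)"
proof -
  obtain a b where "F = ternary_form d a" "G = ternary_form d b"
    using assms by (auto elim!: is_formE)
  then have "(\<lambda>v. F v + G v) = ternary_form d (\<lambda>i j l. a i j l + b i j l)"
    by (auto simp: fun_eq_iff ternary_form_def algebra_simps simp flip: sum.distrib intro!: sum.cong)
  then show ?thesis unfolding is_form_def by blast
qed

lemma is_form_scale:
  assumes "is_form d F"
  shows "is_form d (\<lambda>v. k * F v)"
proof -
  obtain a where "F = ternary_form d a"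
    using assms by (auto elim!: is_formE)
  then have "(\<lambda>v. k * F v) = ternary_form d (\<lambda>i j l. k * a i j l)"
    by (auto simp: fun_eq_iff ternary_form_def sum_distrib_left algebra_simps intro!: sum.cong)
  then show ?thesis unfolding is_form_def by blast
qed

lemma is_form_sum:
  assumes "\<And>m. m \<in> S \<Longrightarrow> is_form d (F m)"
  shows "is_form d (\<lambda>v. \<Sum>m\<in>S. F m v)"
  using assms by (induction S rule: infinite_finite_induct) (auto intro: is_form_zero is_form_add)

lemma is_form_mult:
  assumes "is_form d F" "is_form e G"
  shows "is_form (d + e) (\<lambda>v. F v * G v)"
proof -
  obtain a b where ab: "F = ternary_form d a" "G = ternary_form e b"
    using assms by (auto elim!: is_formE)
  have eq: "F v * G v = (\<Sum>m \<in> {(i, j, l). i + j + l = d}. \<Sum>m' \<in> {(i, j, l). i + j + l = e}.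
      (case m of (i, j, l) \<Rightarrow> case m' of (i', j', l') \<Rightarrow>
        (a i j l * b i' j' l') * (v $ 1) ^ (i + i') * (v $ 2) ^ (j + j') * (v $ 3) ^ (l + l')))" for v
    unfolding ab ternary_form_def sum_product
    by (intro sum.cong refl) (auto simp: power_add algebra_simps)
  show ?thesis unfolding eq
    by (intro is_form_sum) (auto intro!: is_form_monomial)
qed

lemma is_form_const: "is_form 0 (\<lambda>v. k)"
  using is_form_monomial[of 0 0 0 0 k] by simp

lemma is_form_coord: "is_form 1 (\<lambda>v. v $ 1)" "is_form 1 (\<lambda>v. v $ 2)" "is_form 1 (\<lambda>v. v $ 3)"
  using is_form_monomial[of 1 0 0 1 1] is_form_monomial[of 0 1 0 1 1]
    is_form_monomial[of 0 0 1 1 1] by simp_all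

lemma is_form_power:
  assumes "is_form d F"
  shows "is_form (d * k) (\<lambda>v. F v ^ k)"
  by (induction k) (auto intro: is_form_const is_form_mult[OF assms])

lemma is_form_prod:
  assumes "finite S" "\<And>m. m \<in> S \<Longrightarrow> is_form d (F m)"
  shows "is_form (card S * d) (\<lambda>v. \<Prod>m\<in>S. F m v)"
  using assms by (induction S rule: finite_induct) (auto intro: is_form_const is_form_mult)

lemma is_form_compose:
  assumes "is_form d F" "is_form m L1" "is_form m L2" "is_form m L3"
  shows "is_form (m * d) (\<lambda>v. F (vector [L1 v, L2 v, L3 v]))"
proof -
  obtain a where a: "F = ternary_form d a"
    using assms by (auto elim!: is_formE)
  have "is_form (m * d) (\<lambda>v. a i j l * L1 v ^ i * L2 v ^ j * L3 v ^ l)"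
    if "i + j + l = d" for i j l
  proof -
    have "is_form (0 + m * i + m * j + m * l) (\<lambda>v. a i j l * L1 v ^ i * L2 v ^ j * L3 v ^ l)"
      by (intro is_form_mult is_form_power is_form_const assms)
    moreover have "0 + m * i + m * j + m * l = m * d" using that by (simp add: algebra_simps flip: that)
    ultimately show ?thesis by metis
  qed
  then show ?thesis unfolding a ternary_form_def
    by (simp add: case_prod_unfold) (auto intro!: is_form_sum)
qed

lemma vector3_cases: obtains x y z where "(v :: complex ^ 3) = vector [x, y, z]"
proof
  show "v = vector [v $ 1, v $ 2, v $ 3]" by (simp add: vec_eq_iff forall_3)
qed

lemma vector3_eq_iff: "(vector [x, y, z] :: complex ^ 3) = vector [x', y', z'] \<longleftrightarrow> x = x' \<and> y = y' \<and> z = z'"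
  by (auto simp: vec_eq_iff forall_3)

lemma vector3_eq_0_iff: "(vector [x, y, z] :: complex ^ 3) = 0 \<longleftrightarrow> x = 0 \<and> y = 0 \<and> z = 0"
  by (auto simp: vec_eq_iff forall_3)

lemma smult_vector3: "c *s (vector [x, y, z] :: complex ^ 3) = vector [c * x, c * y, c * z]"
  by (auto simp: vec_eq_iff forall_3)

lemma form_along_polynomials:
  assumes "is_form d F"
  shows "\<exists>p. \<forall>t. poly p t = F (vector [poly p1 t, poly p2 t, poly p3 t])"
proof -
  obtain a where a: "F = ternary_form d a"
    using assms by (auto elim!: is_formE)
  show ?thesis unfolding a ternary_form_def
    by (rule exI[of _ "\<Sum>(i, j, l) \<in> {(i, j, l). i + j + l = d}. [:a i j l:] * p1 ^ i * p2 ^ j * p3 ^ l"])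
      (auto simp: poly_sum intro!: sum.cong)
qed

text \<open>Restricted to the line through \<open>v0\<close> and \<open>v\<close>, both forms become univariate polynomials with
  product zero, and the first of them is not the zero polynomial.\<close>

lemma form_mult_eq_0:
  assumes F: "is_form d F" and G: "is_form e G" and "\<And>v. F v * G v = 0" and nz: "F v0 \<noteq> 0"
  shows "G v = 0"
proof -
  let ?p = "\<lambda>i. [:v0 $ i, v $ i - v0 $ i:]"
  obtain p where p: "\<And>t. poly p t = F (vector [poly (?p 1) t, poly (?p 2) t, poly (?p 3) t])"
    using form_along_polynomials[OF F] by blast
  obtain q where q: "\<And>t. poly q t = G (vector [poly (?p 1) t, poly (?p 2) t, poly (?p 3) t])"
    using form_along_polynomials[OF G] by blast
  have "poly (p * q) t = 0" for t by (simp only: poly_mult p q assms(3))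
  then have "p * q = 0" by (metis poly_all_0_iff_0)
  moreover have "vector [v0 $ 1, v0 $ 2, v0 $ 3] = v0" "vector [v $ 1, v $ 2, v $ 3] = v"
    by (simp_all add: vec_eq_iff forall_3)
  then have "poly p 0 = F v0" "poly q 1 = G v" unfolding p q by simp_all
  ultimately show ?thesis using nz by auto
qed

text \<open>The identity principle: the product of \<open>G\<close> with all \<open>L s\<close> vanishes everywhere, and forms
  have no zero divisors.\<close>

lemma form_eq_0_if_generically_0:
  assumes "finite S" and L: "\<And>s. s \<in> S \<Longrightarrow> is_form d (L s)" and nz: "\<And>s. s \<in> S \<Longrightarrow> \<exists>v. L s v \<noteq> 0"
    and G: "is_form e G" and van: "\<And>v. (\<And>s. s \<in> S \<Longrightarrow> L s v \<noteq> 0) \<Longrightarrow> G v = 0"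
  shows "G v = 0"
proof -
  have "\<exists>v. (\<Prod>s\<in>S. L s v) \<noteq> 0" using assms(1) L nz
  proof (induction S rule: finite_induct)
    case (insert s S)
    obtain v1 where "(\<Prod>s\<in>S. L s v1) \<noteq> 0" using insert by blast
    moreover obtain v2 where "L s v2 \<noteq> 0" using insert by blast
    ultimately have "\<not> (\<forall>v. L s v * (\<Prod>s\<in>S. L s v) = 0)"
      using form_mult_eq_0[of d "L s" _ "\<lambda>v. (\<Prod>s\<in>S. L s v)"] is_form_prod[of S d L] insert
      by (metis insertI1 insertI2)
    then show ?case using insert by simp
  qed simp
  then obtain v0 where "(\<Prod>s\<in>S. L s v0) \<noteq> 0" by blast
  moreover have "(\<Prod>s\<in>S. L s v) * G v = 0" for v
    using van[of v] \<open>finite S\<close> by (auto simp: prod_zero_iff)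
  ultimately show ?thesis
    using form_mult_eq_0[of _ "\<lambda>v. \<Prod>s\<in>S. L s v", OF is_form_prod[OF assms(1) L] G] by blast
qed

lemma form_homogeneous:
  assumes "is_form d F"
  shows "F (t *s v) = t ^ d * F v"
proof -
  obtain a where a: "F = ternary_form d a"
    using assms by (auto elim!: is_formE)
  show ?thesis unfolding a ternary_form_def sum_distrib_left
    by (rule sum.cong) (auto simp: power_mult_distrib power_add)
qed

lemma ternary_form_double_sum:
  "ternary_form d c v =
     (\<Sum>i\<le>d. \<Sum>j\<le>d - i. c i j (d - i - j) * (v $ 1) ^ i * (v $ 2) ^ j * (v $ 3) ^ (d - i - j))"
proof -
  have "ternary_form d c v = (\<Sum>(i, j) \<in> (SIGMA i:{..d}. {..d - i}).
     c i j (d - i - j) * (v $ 1) ^ i * (v $ 2) ^ j * (v $ 3) ^ (d - i - j))"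
    unfolding ternary_form_def
    by (rule sum.reindex_bij_witness[of _ "\<lambda>(i, j). (i, j, d - i - j)" "\<lambda>(i, j, l). (i, j)"]) auto
  then show ?thesis by (simp add: sum.Sigma)
qed

text \<open>On the affine chart where the last coordinate is \<open>1\<close>, the form is a polynomial in the first
  coordinate whose coefficients are polynomials in the second, so that the univariate identity
  theorem applies twice.\<close>

lemma ternary_form_eq_0_coeff:
  assumes "\<And>v. ternary_form d c v = 0" "i + j + l = d"
  shows "c i j l = 0"
proof -
  have "(\<Sum>i\<le>d. (\<Sum>j\<le>d - i. c i j (d - i - j) * y ^ j) * x ^ i) = 0" for x y
    using assms(1)[of "vector [x, y, 1]"]
    by (simp add: ternary_form_double_sum sum_distrib_right sum_distrib_left mult_ac)
  then have "\<forall>i\<le>d. (\<Sum>j\<le>d - i. c i j (d - i - j) * y ^ j) = 0" for y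
    using polyfun_eq_0[of "\<lambda>i. \<Sum>j\<le>d - i. c i j (d - i - j) * y ^ j" d] by auto
  then have "\<forall>j\<le>d - i. c i j (d - i - j) = 0"
    using assms(2) polyfun_eq_0[of "\<lambda>j. c i j (d - i - j)" "d - i"] by auto
  moreover have "j \<le> d - i" "d - i - j = l" using assms(2) by auto
  ultimately show ?thesis by metis
qed

lemma form_coeff_unique:
  assumes "ternary_form d c = ternary_form d c'" "i + j + l = d"
  shows "c i j l = c' i j l"
proof -
  have "ternary_form d (\<lambda>i j l. c i j l - c' i j l) v = ternary_form d c v - ternary_form d c' v" for v
    by (auto simp: ternary_form_def algebra_simps simp flip: sum_subtractf intro!: sum.cong)
  then show ?thesis
    using ternary_form_eq_0_coeff[of d "\<lambda>i j l. c i j l - c' i j l" i j l] assms by simp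
qed

lemma form_eq_ternary_form_coeff:
  assumes "is_form d F"
  shows "F = ternary_form d (form_coeff d F)"
  using assms unfolding is_form_def form_coeff_def by (rule someI_ex)

lemma form_coeff_eq:
  assumes "F = ternary_form d c" "i + j + l = d"
  shows "form_coeff d F i j l = c i j l"
proof (rule form_coeff_unique[OF _ assms(2)])
  show "ternary_form d (form_coeff d F) = ternary_form d c"
    using form_eq_ternary_form_coeff[of d F] assms(1) unfolding is_form_def by metis
qed

text \<open>If \<open>m\<close> is the value of the third coordinate on the line, then each monomial of
  \<open>M v - M (v\<^sub>1, v\<^sub>2, m)\<close> contains a difference \<open>v\<^sub>3\<^sup>l - m\<^sup>l\<close>, which is divisible by \<open>v\<^sub>3 - m\<close>. In degree
  \<open>0\<close>, the form \<open>M\<close> and hence the quotient are zero, so the truncated degree \<open>d - 1\<close> does no harm.\<close>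

lemma form_divisible_by_linear:
  assumes M: "is_form d M" and van: "\<And>a b. M (vector [a, b, - u * a - w * b]) = 0"
  shows "\<exists>H. is_form (d - 1) H \<and> (\<forall>v. M v = (v $ 3 + u * v $ 1 + w * v $ 2) * H v)"
proof -
  obtain c where c: "M = ternary_form d c"
    using M by (auto elim!: is_formE)
  define m where "m = (\<lambda>v :: complex ^ 3. - u * v $ 1 - w * v $ 2)"
  have m: "is_form 1 m"
    using is_form_add[OF is_form_scale[OF is_form_coord(1), of "-u"] is_form_scale[OF is_form_coord(2), of "-w"]]
    unfolding m_def by simp
  define H where "H = (\<lambda>v. \<Sum>(i, j, l) \<in> {(i, j, l). i + j + l = d}. \<Sum>q<l.
      c i j l * (v $ 1) ^ i * (v $ 2) ^ j * ((v $ 3) ^ q * m v ^ (l - Suc q)))"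
  have "is_form (d - 1) (\<lambda>v. c i j l * (v $ 1) ^ i * (v $ 2) ^ j * ((v $ 3) ^ q * m v ^ (l - Suc q)))"
    if "i + j + l = d" "q < l" for i j l q
  proof -
    have "is_form (0 + 1 * i + 1 * j + (1 * q + 1 * (l - Suc q)))
       (\<lambda>v. c i j l * (v $ 1) ^ i * (v $ 2) ^ j * ((v $ 3) ^ q * m v ^ (l - Suc q)))"
      by (intro is_form_mult is_form_power is_form_const m is_form_coord)
    moreover have "0 + 1 * i + 1 * j + (1 * q + 1 * (l - Suc q)) = d - 1" using that by simp
    ultimately show ?thesis by metis
  qed
  then have H: "is_form (d - 1) H"
    unfolding H_def by (simp add: case_prod_unfold) (auto intro!: is_form_sum)
  have "M v = (v $ 3 - m v) * H v" for v
  proof -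
    have "M v = M v - M (vector [v $ 1, v $ 2, m v])"
      using van[of "v $ 1" "v $ 2"] by (simp add: m_def)
    also have "\<dots> = (\<Sum>(i, j, l) \<in> {(i, j, l). i + j + l = d}.
        c i j l * (v $ 1) ^ i * (v $ 2) ^ j * ((v $ 3) ^ l - m v ^ l))"
      unfolding c ternary_form_def by (auto simp: algebra_simps simp flip: sum_subtractf intro!: sum.cong)
    also have "\<dots> = (v $ 3 - m v) * H v"
      unfolding H_def sum_distrib_left case_prod_unfold
      by (intro sum.cong refl) (simp add: power_diff_sumr2 sum_distrib_left mult_ac)
    finally show ?thesis .
  qed
  then show ?thesis using H by (intro exI[of _ H]) (auto simp: m_def algebra_simps)
qed

section \<open>Roots of unity\<close>

definition unity_roots :: "nat \<Rightarrow> complex set" where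
  "unity_roots n = {u. u ^ n = 1}"

lemma exp_root_of_unity_power:
  "exp (2 * of_real pi * \<i> / of_nat n) ^ r = cis (2 * pi * real r / real n)"
proof -
  have *: "exp (2 * of_real pi * \<i> / of_nat n) = cis (2 * pi / real n)"
    by (simp add: cis_conv_exp mult_ac)
  show ?thesis unfolding * Complex.DeMoivre by (rule arg_cong[of _ _ cis]) simp
qed

lemma unity_root_power_mod:
  assumes "u \<in> unity_roots n"
  shows "u ^ (r mod n) = u ^ r"
proof -
  have "u ^ r = u ^ (n * (r div n) + r mod n)" by simp
  also have "\<dots> = u ^ (r mod n)"
    using assms unfolding unity_roots_def by (simp only: power_add power_mult mem_Collect_eq power_one mult_1)
  finally show ?thesis ..
qed

text \<open>The exponents of \<open>p_poly\<close> run through \<open>1, \<dots>, n\<close>; reducing them modulo \<open>n\<close> gives the exponents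
  \<open>0, \<dots>, n - 1\<close> without changing the powers.\<close>

lemma bij_betw_unity_roots:
  assumes "n > 0"
  shows "bij_betw (\<lambda>r. exp (2 * of_real pi * \<i> / of_nat n) ^ r) {1..n} (unity_roots n)"
proof -
  let ?e = "exp (2 * of_real pi * \<i> / of_nat n) :: complex"
  have bij: "bij_betw (\<lambda>k. ?e ^ k) {..<n} (unity_roots n)"
    unfolding exp_root_of_unity_power unity_roots_def using assms by (rule Complex.bij_betw_roots_unity)
  have en: "?e \<in> unity_roots n" using assms by (simp add: exp_root_of_unity_power unity_roots_def)
  have "bij_betw (\<lambda>r. r mod n) {1..n} {..<n}"
    by (rule bij_betw_byWitness[where f' = "\<lambda>k. if k = 0 then n else k"])
      (use assms in \<open>auto simp: mod_if\<close>)
  then have "bij_betw ((\<lambda>k. ?e ^ k) \<circ> (\<lambda>r. r mod n)) {1..n} (unity_roots n)"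
    using bij by (rule bij_betw_trans)
  moreover have "?e ^ (r mod n) = ?e ^ r" for r
    by (rule unity_root_power_mod[OF en])
  ultimately show ?thesis by (simp add: o_def)
qed

lemma finite_unity_roots: "n > 0 \<Longrightarrow> finite (unity_roots n)"
  using bij_betw_finite[OF bij_betw_unity_roots] by blast

lemma card_unity_roots: "n > 0 \<Longrightarrow> card (unity_roots n) = n"
  using bij_betw_same_card[OF bij_betw_unity_roots] by simp

lemma unity_root_nonzero: "n > 0 \<Longrightarrow> u \<in> unity_roots n \<Longrightarrow> u \<noteq> 0"
  by (auto simp: unity_roots_def power_0_left)

lemma bij_betw_unity_roots_mult:
  assumes "n > 0" "u \<in> unity_roots n"
  shows "bij_betw ((*) u) (unity_roots n) (unity_roots n)"
  by (rule bij_betw_byWitness[where f' = "\<lambda>w. w / u"])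
    (use assms unity_root_nonzero[OF assms] in \<open>auto simp: unity_roots_def power_mult_distrib power_divide\<close>)

lemma ex_primitive_root:
  assumes "n > 0"
  obtains \<epsilon> :: complex where "\<epsilon> \<in> unity_roots n" "\<And>i. \<epsilon> ^ i = 1 \<Longrightarrow> n dvd i"
proof
  let ?e = "exp (2 * of_real pi * \<i> / of_nat n) :: complex"
  show en: "?e \<in> unity_roots n" using assms by (simp add: exp_root_of_unity_power unity_roots_def)
  fix i assume "?e ^ i = 1"
  moreover have "?e ^ (i mod n) = ?e ^ i"
    by (rule unity_root_power_mod[OF en])
  moreover have "inj_on (\<lambda>k. ?e ^ k) {..<n}"
    unfolding exp_root_of_unity_power using Complex.bij_betw_roots_unity[OF assms] by (rule bij_betw_imp_inj_on)
  ultimately have "i mod n = 0"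
    using inj_onD[of "\<lambda>k. ?e ^ k" "{..<n}" "i mod n" 0] assms by simp
  then show "n dvd i" by auto
qed

lemma root_powr_power:
  assumes "n > 0"
  shows "((x :: complex) powr (1 / of_nat n)) ^ n = x"
proof (cases "x = 0")
  case False
  then show ?thesis using assms by (simp add: powr_def flip: exp_of_nat_mult)
qed (use assms in simp)

text \<open>Multiplying a coordinate by a primitive root of unity multiplies each coefficient by a power
  of that root. As coefficients are unique, only monomials with all exponents divisible by \<open>n\<close> occur.
  (If \<open>n\<close> does not divide \<open>D\<close>, there are none and both forms are zero.)\<close>

lemma invariant_form_is_form_in_powers:
  assumes "n > 0" and K: "is_form D K"
    and inv: "\<And>u a b c. u \<in> unity_roots n \<Longrightarrow> K (vector [u * a, b, c]) = K (vector [a, b, c])"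
      "\<And>u a b c. u \<in> unity_roots n \<Longrightarrow> K (vector [a, u * b, c]) = K (vector [a, b, c])"
      "\<And>u a b c. u \<in> unity_roots n \<Longrightarrow> K (vector [a, b, u * c]) = K (vector [a, b, c])"
  shows "\<exists>H. is_form (D div n) H \<and> (\<forall>a b c. K (vector [a, b, c]) = H (vector [a ^ n, b ^ n, c ^ n]))"
proof -
  obtain k where k: "K = ternary_form D k" using K by (rule is_formE)
  obtain \<epsilon> where \<epsilon>: "\<epsilon> \<in> unity_roots n" "\<And>i. \<epsilon> ^ i = 1 \<Longrightarrow> n dvd i"
    using ex_primitive_root[OF assms(1)] by blast
  have scaled: "ternary_form D (\<lambda>i j l. r ^ i * s ^ j * t ^ l * k i j l) = ternary_form D k"
    if "\<And>a b c. K (vector [r * a, s * b, t * c]) = K (vector [a, b, c])" for r s t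
  proof
    fix v :: "complex ^ 3"
    obtain a b c where v: "v = vector [a, b, c]" by (rule vector3_cases)
    have "ternary_form D (\<lambda>i j l. r ^ i * s ^ j * t ^ l * k i j l) v = K (vector [r * a, s * b, t * c])"
      unfolding k ternary_form_def v by (rule sum.cong) (auto simp: power_mult_distrib)
    then show "ternary_form D (\<lambda>i j l. r ^ i * s ^ j * t ^ l * k i j l) v = ternary_form D k v"
      using that k v by simp
  qed
  have dvd: "n dvd i \<and> n dvd j \<and> n dvd l" if "i + j + l = D" "k i j l \<noteq> 0" for i j l
  proof -
    have "\<epsilon> ^ i = 1"
      using form_coeff_unique[OF scaled[of \<epsilon> 1 1] that(1)] inv(1)[OF \<epsilon>(1)] that(2) by simp
    moreover have "\<epsilon> ^ j = 1"
      using form_coeff_unique[OF scaled[of 1 \<epsilon> 1] that(1)] inv(2)[OF \<epsilon>(1)] that(2) by simp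
    moreover have "\<epsilon> ^ l = 1"
      using form_coeff_unique[OF scaled[of 1 1 \<epsilon>] that(1)] inv(3)[OF \<epsilon>(1)] that(2) by simp
    ultimately show ?thesis using \<epsilon>(2) by blast
  qed
  define I where "I = {m \<in> {(i, j, l). i + j + l = D}. (case m of (i, j, l) \<Rightarrow> n dvd i \<and> n dvd j \<and> n dvd l)}"
  define H where "H = (\<lambda>v :: complex ^ 3. \<Sum>(i, j, l) \<in> I.
    k i j l * (v $ 1) ^ (i div n) * (v $ 2) ^ (j div n) * (v $ 3) ^ (l div n))"
  have deg: "i div n + j div n + l div n = (i + j + l) div n" if "n dvd i" "n dvd j" "n dvd l" for i j l
    using that by (simp add: div_plus_div_distrib_dvd_left)
  have "is_form (D div n) H"
    unfolding H_def case_prod_unfold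
  proof (intro is_form_sum is_form_monomial)
    fix m assume "m \<in> I"
    then obtain i j l where "m = (i, j, l)" "i + j + l = D" "n dvd i" "n dvd j" "n dvd l"
      unfolding I_def by blast
    then show "fst m div n + fst (snd m) div n + snd (snd m) div n = D div n"
      using deg[of i j l] by simp
  qed
  moreover have "K (vector [a, b, c]) = H (vector [a ^ n, b ^ n, c ^ n])" for a b c
  proof -
    have "K (vector [a, b, c]) = (\<Sum>(i, j, l) \<in> I. k i j l * a ^ i * b ^ j * c ^ l)"
      unfolding k ternary_form_def
    proof (rule sum.mono_neutral_cong_right[OF finite_exponents], goal_cases)
      case 2
      show ?case
      proof (intro ballI, clarify)
        fix i j l assume "(i, j, l) \<notin> I" "D = i + j + l"
        then have "k i j l = 0" using dvd[of i j l] unfolding I_def by auto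
        then show "k i j l * (vector [a, b, c] :: complex ^ 3) $ 1 ^ i *
          (vector [a, b, c] :: complex ^ 3) $ 2 ^ j * (vector [a, b, c] :: complex ^ 3) $ 3 ^ l = 0"
          by simp
      qed
    qed (auto simp: I_def)
    also have "\<dots> = H (vector [a ^ n, b ^ n, c ^ n])"
      unfolding H_def by (rule sum.cong) (auto simp: I_def simp flip: power_mult)
    finally show ?thesis .
  qed
  ultimately show ?thesis by blast
qed

section \<open>Parametrization of the curves by a line\<close>

text \<open>The polynomial \<open>p\<^sub>n\<close> after adjoining the \<open>n\<close>-th roots \<open>a\<close>, \<open>b\<close>, \<open>c\<close> of its arguments. Indexing the
  factors by the set of roots of unity makes the invariance under that group a reindexing.\<close>

definition line_product :: "nat \<Rightarrow> complex ^ 3 \<Rightarrow> complex" where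
  "line_product n v = (\<Prod>(u, w) \<in> unity_roots n \<times> unity_roots n. v $ 3 + u * v $ 1 + w * v $ 2)"

lemma is_form_linear: "is_form 1 (\<lambda>v. v $ 3 + u * v $ 1 + w * v $ 2)"
  by (intro is_form_add is_form_scale is_form_coord)

lemma is_form_line_product:
  assumes "n > 0"
  shows "is_form (n * n) (line_product n)"
proof -
  have "is_form (card (unity_roots n \<times> unity_roots n) * 1)
     (\<lambda>v. \<Prod>m \<in> unity_roots n \<times> unity_roots n. v $ 3 + fst m * v $ 1 + snd m * v $ 2)"
    by (intro is_form_prod is_form_linear) (simp add: finite_unity_roots[OF assms])
  then show ?thesis using assms
    by (simp add: line_product_def[abs_def] case_prod_unfold card_cartesian_product card_unity_roots)
qed

lemma line_product_invariant:
  assumes n: "n > 0" and u: "u \<in> unity_roots n"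
  shows "line_product n (vector [u * a, b, c]) = line_product n (vector [a, b, c])"
    "line_product n (vector [a, u * b, c]) = line_product n (vector [a, b, c])"
    "line_product n (vector [a, b, u * c]) = line_product n (vector [a, b, c])"
proof -
  let ?R = "unity_roots n"
  have 1: "line_product n (vector [u * a, b, c]) = line_product n (vector [a, b, c])"
    if u: "u \<in> unity_roots n" for u a b c
  proof -
    have "(\<Prod>r\<in>?R. \<Prod>w\<in>?R. c + (u * r) * a + w * b) = (\<Prod>r\<in>?R. \<Prod>w\<in>?R. c + r * a + w * b)"
      by (rule prod.reindex_bij_betw[OF bij_betw_unity_roots_mult[OF n u]])
    then show ?thesis by (simp add: line_product_def mult_ac flip: prod.cartesian_product)
  qed
  have 2: "line_product n (vector [a, u * b, c]) = line_product n (vector [a, b, c])"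
    if u: "u \<in> unity_roots n" for u a b c
  proof -
    have "(\<Prod>w\<in>?R. c + r * a + (u * w) * b) = (\<Prod>w\<in>?R. c + r * a + w * b)" for r
      by (rule prod.reindex_bij_betw[OF bij_betw_unity_roots_mult[OF n u]])
    then show ?thesis by (simp add: line_product_def mult_ac flip: prod.cartesian_product)
  qed
  show "line_product n (vector [u * a, b, c]) = line_product n (vector [a, b, c])"
    "line_product n (vector [a, u * b, c]) = line_product n (vector [a, b, c])"
    using 1 2 u by auto
  \<comment> \<open>Scaling the last coordinate alone amounts to scaling all three, which multiplies the product by \<open>u\<close> to the power \<open>n\<^sup>2\<close>.\<close>
  have "line_product n (vector [a, b, u * c]) = line_product n (vector [u * a, u * b, u * c])"
    using 1 2 u by simp
  also have "\<dots> = line_product n (u *s vector [a, b, c])" by (simp add: smult_vector3)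
  also have "\<dots> = u ^ (n * n) * line_product n (vector [a, b, c])"
    by (rule form_homogeneous[OF is_form_line_product[OF n]])
  also have "u ^ (n * n) = 1" using u by (simp add: power_mult unity_roots_def)
  finally show "line_product n (vector [a, b, u * c]) = line_product n (vector [a, b, c])" by simp
qed


lemma p_form_eq_line_product:
  assumes "n > 0"
  shows "p_form n v = line_product n (vector [v $ 1 powr (1 / of_nat n), v $ 2 powr (1 / of_nat n), v $ 3 powr (1 / of_nat n)])"
proof -
  let ?e = "exp (2 * of_real pi * \<i> / of_nat n) :: complex"
  let ?R = "unity_roots n"
  note re = prod.reindex_bij_betw[OF bij_betw_unity_roots[OF assms]]
  have "(\<Prod>r = 1..n. \<Prod>s = 1..n. (c + ?e ^ r * a + ?e ^ s * b)) = (\<Prod>u\<in>?R. \<Prod>w\<in>?R. c + u * a + w * b)" for a b c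
    using re[of "\<lambda>u. \<Prod>w\<in>?R. c + u * a + w * b"] re[of "\<lambda>w. c + _ * a + w * b"] by simp
  then show ?thesis
    by (simp add: p_form_def p_poly_def line_product_def Let_def flip: prod.cartesian_product)
qed

text \<open>The principal roots in the definition of \<open>p\<^sub>n\<close> may be replaced by any others, since the product is
  a function of their \<open>n\<close>-th powers.\<close>

lemma p_form_in_powers:
  assumes "n > 0"
  shows is_form_p_form: "is_form n (p_form n)"
    and p_form_powers: "p_form n (vector [a ^ n, b ^ n, c ^ n]) = line_product n (vector [a, b, c])"
proof -
  have "\<exists>H. is_form (n * n div n) H \<and>
      (\<forall>a b c. line_product n (vector [a, b, c]) = H (vector [a ^ n, b ^ n, c ^ n]))"
    by (rule invariant_form_is_form_in_powers[OF assms is_form_line_product[OF assms]])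
      (simp_all only: line_product_invariant[OF assms])
  then obtain H where H: "is_form (n * n div n) H"
    "\<And>a b c. line_product n (vector [a, b, c]) = H (vector [a ^ n, b ^ n, c ^ n])"
    by blast
  have "p_form n v = H v" for v
  proof -
    have "vector [v $ 1, v $ 2, v $ 3] = v" by (simp add: vec_eq_iff forall_3)
    then show ?thesis
      by (simp only: p_form_eq_line_product[OF assms] H(2) root_powr_power[OF assms])
  qed
  then have "p_form n = H" by auto
  then show "is_form n (p_form n)"
    "p_form n (vector [a ^ n, b ^ n, c ^ n]) = line_product n (vector [a, b, c])"
    using H assms by simp_all
qed

text \<open>The roots of unity of a vanishing linear factor can be absorbed into the chosen \<open>n\<close>-th
  roots, so that the factor becomes \<open>a + b + c\<close>.\<close>

lemma p_form_eq_0_iff: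
  assumes "n > 0"
  shows "p_form n v = 0 \<longleftrightarrow> (\<exists>a b c. a + b + c = 0 \<and> v = vector [a ^ n, b ^ n, c ^ n])"
proof
  assume "p_form n v = 0"
  then have "line_product n (vector [v $ 1 powr (1 / of_nat n), v $ 2 powr (1 / of_nat n), v $ 3 powr (1 / of_nat n)]) = 0"
    using p_form_eq_line_product[OF assms] by simp
  then obtain u w where uw: "u \<in> unity_roots n" "w \<in> unity_roots n"
    "v $ 3 powr (1 / of_nat n) + u * v $ 1 powr (1 / of_nat n) + w * v $ 2 powr (1 / of_nat n) = 0"
    unfolding line_product_def by (auto simp: prod_zero_iff finite_unity_roots[OF assms] simp del: powr_nat)
  have "v = vector [(u * v $ 1 powr (1 / of_nat n)) ^ n, (w * v $ 2 powr (1 / of_nat n)) ^ n, (v $ 3 powr (1 / of_nat n)) ^ n]"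
    using uw by (simp add: power_mult_distrib root_powr_power[OF assms] unity_roots_def vec_eq_iff forall_3)
  moreover have "u * v $ 1 powr (1 / of_nat n) + w * v $ 2 powr (1 / of_nat n) + v $ 3 powr (1 / of_nat n) = 0"
    using uw(3) by (simp add: algebra_simps)
  ultimately show "\<exists>a b c. a + b + c = 0 \<and> v = vector [a ^ n, b ^ n, c ^ n]" by blast
next
  assume "\<exists>a b c. a + b + c = 0 \<and> v = vector [a ^ n, b ^ n, c ^ n]"
  then obtain a b c where "a + b + c = 0" "v = vector [a ^ n, b ^ n, c ^ n]" by blast
  moreover have "(1, 1) \<in> unity_roots n \<times> unity_roots n" by (simp add: unity_roots_def)
  ultimately have "line_product n (vector [a, b, c]) = 0"
    unfolding line_product_def
    by (intro prod_zero bexI[of _ "(1, 1)"]) (auto simp: finite_unity_roots[OF assms] algebra_simps)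
  then show "p_form n v = 0" using p_form_powers[OF assms] \<open>v = _\<close> by simp
qed

section \<open>Reducedness of the equations\<close>

text \<open>The quotient by the lines treated so far still vanishes on the next line, because those
  lines meet it in one point each, and a form on a line that vanishes off finitely many points is
  zero.\<close>

lemma form_divisible_by_lines:
  assumes "finite S" and K: "is_form D K"
    and "\<And>u w a b. (u, w) \<in> S \<Longrightarrow> K (vector [a, b, - u * a - w * b]) = 0"
  shows "\<exists>e M. is_form e M \<and> (\<forall>v. K v = (\<Prod>(u, w) \<in> S. v $ 3 + u * v $ 1 + w * v $ 2) * M v)"
  using assms(1,3)
proof (induction S rule: finite_induct)
  case empty
  then show ?case using K by auto
next
  case (insert m S)
  obtain u w where m: "m = (u, w)" by (cases m)
  let ?L = "\<lambda>s v :: complex ^ 3. v $ 3 + fst s * v $ 1 + snd s * v $ 2"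
  obtain e M where M: "is_form e M" "\<And>v. K v = (\<Prod>(u, w) \<in> S. v $ 3 + u * v $ 1 + w * v $ 2) * M v"
    using insert by blast
  let ?q = "\<lambda>v :: complex ^ 3. (vector [v $ 1, v $ 2, - u * v $ 1 - w * v $ 2] :: complex ^ 3)"
  have 3: "is_form 1 (\<lambda>v. - u * v $ 1 - w * v $ 2)"
    using is_form_add[OF is_form_scale[OF is_form_coord(1), of "-u"] is_form_scale[OF is_form_coord(2), of "-w"]]
    by simp
  have sub: "is_form (1 * d) (\<lambda>v. G (?q v))" if "is_form d G" for d G
    by (intro is_form_compose that is_form_coord 3)
  have "M (?q v) = 0" for v
  proof (rule form_eq_0_if_generically_0[OF \<open>finite S\<close>,
      where L = "\<lambda>s v. ?L s (?q v)" and d = "1 * 1" and G = "\<lambda>v. M (?q v)" and e = "1 * e"])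
    fix s assume "s \<in> S"
    show "is_form (1 * 1) (\<lambda>v. ?L s (?q v))" by (rule sub[OF is_form_linear])
    have "fst s \<noteq> u \<or> snd s \<noteq> w" using \<open>s \<in> S\<close> insert(2) m by auto
    then show "\<exists>v. ?L s (?q v) \<noteq> 0"
    proof
      assume "fst s \<noteq> u" then show ?thesis by (intro exI[of _ "vector [1, 0, 0]"]) simp
    next
      assume "snd s \<noteq> w" then show ?thesis by (intro exI[of _ "vector [0, 1, 0]"]) simp
    qed
  next
    show "is_form (1 * e) (\<lambda>v. M (?q v))" by (rule sub[OF M(1)])
    fix v assume *: "\<And>s. s \<in> S \<Longrightarrow> ?L s (?q v) \<noteq> 0"
    have "K (?q v) = 0" using insert(4)[of u w "v $ 1" "v $ 2"] m by simp
    moreover have "(\<Prod>(u, w) \<in> S. ?q v $ 3 + u * ?q v $ 1 + w * ?q v $ 2) \<noteq> 0"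
      using * \<open>finite S\<close> by (auto simp: prod_zero_iff case_prod_unfold)
    ultimately show "M (?q v) = 0" using M(2)[of "?q v"] by simp
  qed
  from this[of "vector [_, _, 0]"] have "M (vector [a, b, - u * a - w * b]) = 0" for a b by simp
  from form_divisible_by_linear[OF M(1) this] obtain H where
    "is_form (e - 1) H" "\<And>v. M v = (v $ 3 + u * v $ 1 + w * v $ 2) * H v" by blast
  then show ?case using insert M(2) m by (intro exI[of _ "e - 1"] exI[of _ H]) (simp add: mult_ac)
qed

lemma proportional_refl_iff: "proportional v v \<longleftrightarrow> v \<noteq> 0"
  unfolding proportional_def by (auto intro: exI[of _ 1])

lemma point_eq_iff:
  assumes "v \<noteq> 0" "w \<noteq> 0"
  shows "point v = point w \<longleftrightarrow> (\<exists>c. c \<noteq> 0 \<and> w = c *s v)"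
  using Quotient3_rel[OF Quotient3_proj, of v w] assms
  by (simp add: proportional_refl_iff) (simp add: proportional_def)

lemma coords_point:
  assumes "v \<noteq> 0"
  obtains c where "c \<noteq> 0" "coords (point v) = c *s v"
proof -
  have "proportional v (coords (point v))"
    using Quotient3_rep_abs[OF Quotient3_proj, of v] Quotient3_symp[OF Quotient3_proj] assms
    by (meson proportional_refl_iff sympD)
  then show ?thesis using that unfolding proportional_def by blast
qed

lemma mem_zero_locus_iff:
  assumes "is_form d F" "v \<noteq> 0"
  shows "point v \<in> zero_locus F \<longleftrightarrow> F v = 0"
proof
  assume "point v \<in> zero_locus F"
  then obtain w where w: "w \<noteq> 0" "F w = 0" "point w = point v" unfolding zero_locus_def by auto
  then obtain c where "v = c *s w" using point_eq_iff[of w v] assms(2) by metis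
  then show "F v = 0" using form_homogeneous[OF assms(1)] w by simp
qed (use assms in \<open>auto simp: zero_locus_def\<close>)

lemma mem_curve_X_iff: "n > 0 \<Longrightarrow> v \<noteq> 0 \<Longrightarrow> point v \<in> curve_X n \<longleftrightarrow> p_form n v = 0"
  unfolding curve_X_def by (rule mem_zero_locus_iff[OF is_form_p_form])

text \<open>The zero vector, which represents no point of the plane, is covered by
  homogeneity: \<open>G\<close> vanishes at a point of the curve, hence at \<open>0\<close> times that point.\<close>

lemma vanishes_on_curve_X:
  assumes n: "n > 0" and G: "is_form d G" and van: "vanishes_on G (curve_X n)" and abc: "a + b + c = 0"
  shows "G (vector [a ^ n, b ^ n, c ^ n]) = 0"
proof -
  have *: "G v = 0" if "v \<noteq> 0" "p_form n v = 0" for v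
    using van that mem_curve_X_iff[OF n] unfolding vanishes_on_def by blast
  show ?thesis
  proof (cases "(vector [a ^ n, b ^ n, c ^ n] :: complex ^ 3) = 0")
    case False
    then show ?thesis using abc by (intro *) (auto simp: p_form_eq_0_iff[OF n])
  next
    case True
    let ?w = "vector [1 ^ n, (-1) ^ n, 0 ^ n] :: complex ^ 3"
    have "p_form n ?w = 0"
      unfolding p_form_eq_0_iff[OF n] by (intro exI[of _ 1] exI[of _ "-1"] exI[of _ 0]) simp
    then have "G ?w = 0" by (intro *) (simp add: vector3_eq_0_iff)
    then have "G (0 *s ?w) = 0" using form_homogeneous[OF G, of 0 ?w] by simp
    then show ?thesis using True by simp
  qed
qed

text \<open>Let \<open>G\<close> vanish on the curve. Then \<open>K(a, b, c) = G(a\<^sup>n, b\<^sup>n, c\<^sup>n)\<close> vanishes on every line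
  \<open>c + u a + w b = 0\<close>, so it is a multiple \<open>P M\<close> of the product \<open>P\<close> of these distinct linear forms. Since
  \<open>K\<close> and \<open>P\<close> are invariant under the roots of unity and \<open>P\<close> is no zero divisor, \<open>M\<close> is invariant too
  and hence is a form in \<open>a\<^sup>n\<close>, \<open>b\<^sup>n\<close>, \<open>c\<^sup>n\<close>.\<close>

lemma defining_form_p_form:
  assumes n: "n > 0"
  shows "defining_form n (p_form n) (curve_X n)"
  unfolding defining_form_def
proof (intro conjI allI impI)
  show "is_form n (p_form n)" by (rule is_form_p_form[OF n])
  show "curve_X n = zero_locus (p_form n)" by (rule curve_X_def)
  fix e G assume "is_form e G \<and> vanishes_on G (curve_X n)"
  then have G: "is_form e G" and van: "vanishes_on G (curve_X n)" by auto
  define K where "K = (\<lambda>v :: complex ^ 3. G (vector [v $ 1 ^ n, v $ 2 ^ n, v $ 3 ^ n]))"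
  have K: "is_form (1 * n * e) K"
    unfolding K_def by (intro is_form_compose G is_form_power is_form_coord)
  have "K (vector [a, b, - u * a - w * b]) = 0" if "(u, w) \<in> unity_roots n \<times> unity_roots n" for u w a b
    using vanishes_on_curve_X[OF n G van, of "u * a" "w * b" "- u * a - w * b"] that
    by (simp add: K_def power_mult_distrib unity_roots_def)
  then obtain e' M where M: "is_form e' M" "\<And>v. K v = line_product n v * M v"
    using form_divisible_by_lines[OF _ K, of "unity_roots n \<times> unity_roots n"] finite_unity_roots[OF n]
    unfolding line_product_def by blast
  have cancel: "M (vector [u1 * a, u2 * b, u3 * c]) = M (vector [a, b, c])"
    if u: "u1 \<in> unity_roots n" "u2 \<in> unity_roots n" "u3 \<in> unity_roots n" for u1 u2 u3 a b c
  proof -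
    have lp: "line_product n (vector [u1 * a, u2 * b, u3 * c]) = line_product n (vector [a, b, c])" for a b c
      using u line_product_invariant[OF n] by simp
    have inv: "K (vector [u1 * a, u2 * b, u3 * c]) = K (vector [a, b, c])" for a b c
      using u by (simp add: K_def power_mult_distrib unity_roots_def)
    let ?D = "\<lambda>v :: complex ^ 3. M (vector [u1 * v $ 1, u2 * v $ 2, u3 * v $ 3]) + (-1) * M v"
    have M1: "is_form (1 * e') (\<lambda>v. M (vector [u1 * v $ 1, u2 * v $ 2, u3 * v $ 3]))"
      by (intro is_form_compose M is_form_scale is_form_coord)
    have D: "is_form e' ?D"
      using is_form_add[OF M1[simplified] is_form_scale[OF M(1), of "-1"]] by simp
    have "line_product n v * ?D v = 0" for v
    proof -
      obtain a b c where v: "v = vector [a, b, c]" by (rule vector3_cases)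
      show ?thesis using inv[of a b c] lp[of a b c] by (simp add: v M(2) algebra_simps)
    qed
    from form_mult_eq_0[OF is_form_line_product[OF n] D this, of "vector [0, 0, 1]" "vector [a, b, c]"]
    have "?D (vector [a, b, c]) = 0"
      by (simp add: line_product_def)
    then show ?thesis by simp
  qed
  have one: "1 \<in> unity_roots n" by (simp add: unity_roots_def)
  have "\<exists>H. is_form (e' div n) H \<and> (\<forall>a b c. M (vector [a, b, c]) = H (vector [a ^ n, b ^ n, c ^ n]))"
    by (rule invariant_form_is_form_in_powers[OF n M(1)])
      (use cancel[OF _ one one] cancel[OF one _ one] cancel[OF one one] in \<open>simp_all only: mult_1\<close>)
  then obtain H where H: "is_form (e' div n) H"
    "\<And>a b c. M (vector [a, b, c]) = H (vector [a ^ n, b ^ n, c ^ n])"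
    by blast
  have "G v = p_form n v * H v" for v
  proof -
    obtain x y z where v: "v = vector [x, y, z]" by (rule vector3_cases)
    obtain a b c where "x = a ^ n" "y = b ^ n" "z = c ^ n" using root_powr_power[OF n] by metis
    then show ?thesis using M(2)[of "vector [a, b, c]"] H(2) p_form_powers[OF n] by (simp add: v K_def)
  qed
  then show "\<exists>h H. is_form h H \<and> (\<forall>v. G v = p_form n v * H v)" using H(1) by blast
qed

section \<open>Gradients along the curves\<close>

lemma form_chain_rule:
  assumes F: "is_form d F"
    and f: "(f1 has_field_derivative D1) (at t)" "(f2 has_field_derivative D2) (at t)"
      "(f3 has_field_derivative D3) (at t)"
  shows "((\<lambda>s. F (vector [f1 s, f2 s, f3 s])) has_field_derivative
    scalar_product (gradient F (vector [f1 t, f2 t, f3 t])) (vector [D1, D2, D3])) (at t)"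
proof -
  obtain c where c: "F = ternary_form d c" using F by (rule is_formE)
  let ?T = "{(i, j, l). i + j + l = d}"
  define P where "P k v = (\<Sum>(i, j, l)\<in>?T. c i j l *
      (if k = 1 then of_nat i * (v $ 1) ^ (i - 1) * (v $ 2) ^ j * (v $ 3) ^ l
       else if k = 2 then (v $ 1) ^ i * (of_nat j * (v $ 2) ^ (j - 1)) * (v $ 3) ^ l
       else (v $ 1) ^ i * (v $ 2) ^ j * (of_nat l * (v $ 3) ^ (l - 1))))"
    for k :: 3 and v :: "complex ^ 3"
  have chain: "((\<lambda>s. F (vector [f1 s, f2 s, f3 s])) has_field_derivative
      P 1 (vector [f1 t, f2 t, f3 t]) * D1 + P 2 (vector [f1 t, f2 t, f3 t]) * D2
      + P 3 (vector [f1 t, f2 t, f3 t]) * D3) (at t)"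
    if f: "(f1 has_field_derivative D1) (at t)" "(f2 has_field_derivative D2) (at t)"
      "(f3 has_field_derivative D3) (at t)" for f1 f2 f3 D1 D2 D3 and t :: complex
  proof -
    have "((\<lambda>s. c i j l * f1 s ^ i * f2 s ^ j * f3 s ^ l) has_field_derivative
       c i j l * (of_nat i * f1 t ^ (i - 1) * f2 t ^ j * f3 t ^ l) * D1
       + c i j l * (f1 t ^ i * (of_nat j * f2 t ^ (j - 1)) * f3 t ^ l) * D2
       + c i j l * (f1 t ^ i * f2 t ^ j * (of_nat l * f3 t ^ (l - 1))) * D3) (at t)" for i j l
      by (rule derivative_eq_intros f refl)+ (simp add: algebra_simps)
    then have "((\<lambda>s. \<Sum>(i, j, l)\<in>?T. c i j l * f1 s ^ i * f2 s ^ j * f3 s ^ l) has_field_derivative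
       (\<Sum>(i, j, l)\<in>?T. c i j l * (of_nat i * f1 t ^ (i - 1) * f2 t ^ j * f3 t ^ l) * D1
       + c i j l * (f1 t ^ i * (of_nat j * f2 t ^ (j - 1)) * f3 t ^ l) * D2
       + c i j l * (f1 t ^ i * f2 t ^ j * (of_nat l * f3 t ^ (l - 1))) * D3)) (at t)"
      unfolding case_prod_unfold by (intro DERIV_sum)
    moreover have "(\<Sum>(i, j, l)\<in>?T. c i j l * (of_nat i * f1 t ^ (i - 1) * f2 t ^ j * f3 t ^ l) * D1
       + c i j l * (f1 t ^ i * (of_nat j * f2 t ^ (j - 1)) * f3 t ^ l) * D2
       + c i j l * (f1 t ^ i * f2 t ^ j * (of_nat l * f3 t ^ (l - 1))) * D3) =
      P 1 (vector [f1 t, f2 t, f3 t]) * D1 + P 2 (vector [f1 t, f2 t, f3 t]) * D2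
      + P 3 (vector [f1 t, f2 t, f3 t]) * D3"
      unfolding P_def sum_distrib_right case_prod_unfold by (simp flip: sum.distrib)
    ultimately show ?thesis by (simp add: c ternary_form_def)
  qed
  \<comment> \<open>The gradient is the special case of the chain rule where the curve is a line parallel to an axis.\<close>
  have grad: "gradient F v $ k = P k v" for v k
  proof -
    have v: "vector [v $ 1, v $ 2, v $ 3] = v" by (simp add: vec_eq_iff forall_3)
    have "(\<lambda>t. F (v + t *s axis k 1)) = (\<lambda>t. F (vector [v $ 1 + (if k = 1 then t else 0),
        v $ 2 + (if k = 2 then t else 0), v $ 3 + (if k = 3 then t else 0)]))"
      by (intro ext arg_cong[of _ _ F]) (auto simp: vec_eq_iff forall_3 axis_def)
    moreover have "((\<lambda>t. F (vector [v $ 1 + (if k = 1 then t else 0),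
        v $ 2 + (if k = 2 then t else 0), v $ 3 + (if k = 3 then t else 0)])) has_field_derivative
      P 1 v * (if k = 1 then 1 else 0) + P 2 v * (if k = 2 then 1 else 0)
        + P 3 v * (if k = 3 then 1 else 0)) (at 0)"
      by (rule chain[where t = 0, THEN DERIV_cong]) (auto intro!: derivative_eq_intros simp: v)
    moreover have "k = 1 \<or> k = 2 \<or> k = 3" using exhaust_3 by blast
    then have "P 1 v * (if k = 1 then 1 else 0) + P 2 v * (if k = 2 then 1 else 0)
        + P 3 v * (if k = 3 then 1 else 0) = P k v" by auto
    ultimately show ?thesis unfolding gradient_def by (simp add: DERIV_imp_deriv)
  qed
  show ?thesis using chain[OF f] by (simp add: scalar_product_def sum_3 grad)
qed

text \<open>\<open>G\<close> vanishes along each curve \<open>s \<mapsto> ((a + s p)\<^sup>n, (b + s q)\<^sup>n, (c + s r)\<^sup>n)\<close> with \<open>p + q + r = 0\<close>;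
  the claims are its derivatives at \<open>s = 0\<close> for \<open>(p, q, r) = (1, -1, 0)\<close> and \<open>(0, 1, -1)\<close>.\<close>

lemma gradient_on_curve_X:
  assumes n: "n > 0" and G: "is_form e G" and van: "vanishes_on G (curve_X n)" and abc: "a + b + c = 0"
  shows "gradient G (vector [a ^ n, b ^ n, c ^ n]) $ 1 * a ^ (n - 1) =
      gradient G (vector [a ^ n, b ^ n, c ^ n]) $ 2 * b ^ (n - 1)"
    and "gradient G (vector [a ^ n, b ^ n, c ^ n]) $ 2 * b ^ (n - 1) =
      gradient G (vector [a ^ n, b ^ n, c ^ n]) $ 3 * c ^ (n - 1)"
proof -
  let ?g = "gradient G (vector [a ^ n, b ^ n, c ^ n])"
  have gen: "?g $ 1 * (p * a ^ (n - 1)) + ?g $ 2 * (q * b ^ (n - 1)) + ?g $ 3 * (r * c ^ (n - 1)) = 0"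
    if pqr: "p + q + r = 0" for p q r
  proof -
    have der: "((\<lambda>s. (x + s * y) ^ n) has_field_derivative of_nat n * (y * x ^ (n - 1))) (at 0)" for x y :: complex
      by (auto intro!: derivative_eq_intros)
    have "((\<lambda>s. G (vector [(a + s * p) ^ n, (b + s * q) ^ n, (c + s * r) ^ n])) has_field_derivative
        scalar_product (gradient G (vector [(a + 0 * p) ^ n, (b + 0 * q) ^ n, (c + 0 * r) ^ n]))
         (vector [of_nat n * (p * a ^ (n - 1)), of_nat n * (q * b ^ (n - 1)), of_nat n * (r * c ^ (n - 1))])) (at 0)"
      by (rule form_chain_rule[OF G der der der])
    moreover have "(\<lambda>s. G (vector [(a + s * p) ^ n, (b + s * q) ^ n, (c + s * r) ^ n])) = (\<lambda>s. 0)"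
    proof
      fix s
      have "(a + s * p) + (b + s * q) + (c + s * r) = (a + b + c) + s * (p + q + r)"
        by (simp add: algebra_simps)
      also have "\<dots> = 0" using abc pqr by simp
      finally show "G (vector [(a + s * p) ^ n, (b + s * q) ^ n, (c + s * r) ^ n]) = 0"
        by (rule vanishes_on_curve_X[OF n G van])
    qed
    ultimately have "scalar_product ?g (vector [of_nat n * (p * a ^ (n - 1)), of_nat n * (q * b ^ (n - 1)),
        of_nat n * (r * c ^ (n - 1))]) = 0"
      using DERIV_unique[OF _ DERIV_const] by simp
    then have "of_nat n * (?g $ 1 * (p * a ^ (n - 1)) + ?g $ 2 * (q * b ^ (n - 1)) + ?g $ 3 * (r * c ^ (n - 1))) = 0"
      by (simp add: scalar_product_def sum_3 algebra_simps)
    then show ?thesis using n by simp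
  qed
  show "?g $ 1 * a ^ (n - 1) = ?g $ 2 * b ^ (n - 1)" using gen[of 1 "-1" 0] by simp
  show "?g $ 2 * b ^ (n - 1) = ?g $ 3 * c ^ (n - 1)" using gen[of 0 1 "-1"] by simp
qed

text \<open>In \<open>p\<^sub>n(a\<^sup>n, b\<^sup>n, (c + s)\<^sup>n)\<close> the factor \<open>a + b + c + s\<close> equals \<open>s\<close>, so the derivative at
  \<open>s = 0\<close> is the product of the remaining factors at \<open>s = 0\<close>.\<close>

lemma gradient_p_form_nonzero:
  assumes n: "n > 0" and abc: "a + b + c = 0"
    and others: "\<And>u w. (u, w) \<in> unity_roots n \<times> unity_roots n - {(1, 1)} \<Longrightarrow> c + u * a + w * b \<noteq> 0"
  shows "gradient (p_form n) (vector [a ^ n, b ^ n, c ^ n]) $ 3 \<noteq> 0"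
proof -
  let ?S = "unity_roots n \<times> unity_roots n"
  have fin: "finite ?S" by (simp add: finite_unity_roots[OF n])
  have one: "(1, 1) \<in> ?S" by (simp add: unity_roots_def)
  define Rest where "Rest s = (\<Prod>(u, w) \<in> ?S - {(1, 1)}. c + s + u * a + w * b)" for s
  have "((\<lambda>s. p_form n (vector [a ^ n, b ^ n, (c + s) ^ n])) has_field_derivative
      scalar_product (gradient (p_form n) (vector [a ^ n, b ^ n, (c + 0) ^ n]))
       (vector [0, 0, of_nat n * c ^ (n - 1)])) (at 0)"
    by (rule form_chain_rule[OF is_form_p_form[OF n]]) (auto intro!: derivative_eq_intros)
  moreover have "p_form n (vector [a ^ n, b ^ n, (c + s) ^ n]) = s * Rest s" for s
  proof -
    have "p_form n (vector [a ^ n, b ^ n, (c + s) ^ n]) = (\<Prod>(u, w) \<in> ?S. c + s + u * a + w * b)"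
      by (simp add: p_form_powers[OF n] line_product_def)
    also have "\<dots> = (c + s + a + b) * Rest s"
      unfolding Rest_def by (subst prod.remove[OF fin one]) simp
    also have "c + s + a + b = s" using abc by (simp add: algebra_simps)
    finally show ?thesis .
  qed
  moreover have "((\<lambda>s. s * Rest s) has_field_derivative Rest 0) (at 0)"
  proof -
    have "Rest field_differentiable (at 0)"
      unfolding Rest_def[abs_def] case_prod_unfold
      by (rule holomorphic_on_imp_differentiable_at[of _ UNIV]) (auto intro!: holomorphic_intros)
    then obtain D where "(Rest has_field_derivative D) (at 0)" unfolding field_differentiable_def by blast
    then show ?thesis by (auto intro!: derivative_eq_intros)
  qed
  ultimately have "scalar_product (gradient (p_form n) (vector [a ^ n, b ^ n, c ^ n]))
       (vector [0, 0, of_nat n * c ^ (n - 1)]) = Rest 0"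
    by (simp add: DERIV_unique)
  moreover have "Rest 0 \<noteq> 0"
    unfolding Rest_def using others fin by (auto simp: prod_zero_iff)
  ultimately show ?thesis by (auto simp: scalar_product_def sum_3)
qed

section \<open>Inverted forms\<close>

lemma is_form_inverted_form:
  assumes "is_form d F"
  shows "is_form (2 * d) (inverted_form d F)"
proof -
  have "is_form (2 * d) (\<lambda>v. form_coeff d F i j l * ((vector [1, v $ 1] :: complex ^ 2) $ 1 ^ i * (vector [1, v $ 1] :: complex ^ 2) $ 2 ^ (d - i)) *
     ((vector [1, v $ 2] :: complex ^ 2) $ 1 ^ j * (vector [1, v $ 2] :: complex ^ 2) $ 2 ^ (d - j)) *
     ((vector [1, v $ 3] :: complex ^ 2) $ 1 ^ l * (vector [1, v $ 3] :: complex ^ 2) $ 2 ^ (d - l)))"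
    if "i + j + l = d" for i j l
  proof -
    have "(d - i) + (d - j) + (d - l) = 2 * d" using that by auto
    then show ?thesis
      using is_form_monomial[of "d - i" "d - j" "d - l" "2 * d" "form_coeff d F i j l"] by simp
  qed
  then show ?thesis
    unfolding inverted_form_def[abs_def] cleared_def case_prod_unfold
    by (intro is_form_sum) auto
qed

lemma inverted_form_eq:
  assumes "is_form d F" "u \<noteq> 0" "v \<noteq> 0" "w \<noteq> 0"
  shows "inverted_form d F (vector [u, v, w]) = (u * v * w) ^ d * F (vector [1 / u, 1 / v, 1 / w])"
  unfolding inverted_form_def using cleared_eq[OF assms(1)] assms(2-4) by simp

lemma form_coeff_axis:
  assumes "is_form d F"
  shows "form_coeff d F d 0 0 = F (vector [1, 0, 0])"
    and "form_coeff d F 0 d 0 = F (vector [0, 1, 0])"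
    and "form_coeff d F 0 0 d = F (vector [0, 0, 1])"
proof -
  let ?T = "{(i, j, l). i + j + l = d}"
  have F: "F v = (\<Sum>(i, j, l) \<in> ?T. form_coeff d F i j l * (v $ 1) ^ i * (v $ 2) ^ j * (v $ 3) ^ l)" for v
    using form_eq_ternary_form_coeff[OF assms] unfolding ternary_form_def by metis
  have "F (vector [1, 0, 0]) = (\<Sum>m \<in> {(d, 0, 0) :: nat \<times> nat \<times> nat}. form_coeff d F d 0 0)"
    by (subst F, rule sum.mono_neutral_cong_right[OF finite_exponents]) auto
  then show "form_coeff d F d 0 0 = F (vector [1, 0, 0])" by simp
  have "F (vector [0, 1, 0]) = (\<Sum>m \<in> {(0, d, 0) :: nat \<times> nat \<times> nat}. form_coeff d F 0 d 0)"
    by (subst F, rule sum.mono_neutral_cong_right[OF finite_exponents]) auto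
  then show "form_coeff d F 0 d 0 = F (vector [0, 1, 0])" by simp
  have "F (vector [0, 0, 1]) = (\<Sum>m \<in> {(0, 0, d) :: nat \<times> nat \<times> nat}. form_coeff d F 0 0 d)"
    by (subst F, rule sum.mono_neutral_cong_right[OF finite_exponents]) auto
  then show "form_coeff d F 0 0 d = F (vector [0, 0, 1])" by simp
qed

text \<open>When one coordinate is zero, a monomial of the inverted form survives only if the
  corresponding exponent in \<open>F\<close> is the full degree, and the coefficient of that monomial is a value of \<open>F\<close>
  at a coordinate point.\<close>

lemma inverted_form_on_axes:
  assumes "is_form d F"
  shows "inverted_form d F (vector [0, v, w]) = F (vector [1, 0, 0]) * (v * w) ^ d"
    and "inverted_form d F (vector [u, 0, w]) = F (vector [0, 1, 0]) * (u * w) ^ d"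
    and "inverted_form d F (vector [u, v, 0]) = F (vector [0, 0, 1]) * (u * v) ^ d"
proof -
  have "inverted_form d F (vector [0, v, w]) = (\<Sum>m \<in> {(d, 0, 0) :: nat \<times> nat \<times> nat}. form_coeff d F d 0 0 * (v * w) ^ d)"
    unfolding inverted_form_def cleared_def
    by (rule sum.mono_neutral_cong_right[OF finite_exponents]) (auto simp: power_mult_distrib power_0_left split: if_splits)
  then show "inverted_form d F (vector [0, v, w]) = F (vector [1, 0, 0]) * (v * w) ^ d"
    by (simp add: form_coeff_axis[OF assms])
  have "inverted_form d F (vector [u, 0, w]) = (\<Sum>m \<in> {(0, d, 0) :: nat \<times> nat \<times> nat}. form_coeff d F 0 d 0 * (u * w) ^ d)"
    unfolding inverted_form_def cleared_def
    by (rule sum.mono_neutral_cong_right[OF finite_exponents]) (auto simp: power_mult_distrib power_0_left split: if_splits)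
  then show "inverted_form d F (vector [u, 0, w]) = F (vector [0, 1, 0]) * (u * w) ^ d"
    by (simp add: form_coeff_axis[OF assms])
  have "inverted_form d F (vector [u, v, 0]) = (\<Sum>m \<in> {(0, 0, d) :: nat \<times> nat \<times> nat}. form_coeff d F 0 0 d * (u * v) ^ d)"
    unfolding inverted_form_def cleared_def
    by (rule sum.mono_neutral_cong_right[OF finite_exponents]) (auto simp: power_mult_distrib power_0_left split: if_splits)
  then show "inverted_form d F (vector [u, v, 0]) = F (vector [0, 0, 1]) * (u * v) ^ d"
    by (simp add: form_coeff_axis[OF assms])
qed

lemma p_form_axes_nonzero:
  assumes "n > 0"
  shows "p_form n (vector [1, 0, 0]) \<noteq> 0" "p_form n (vector [0, 1, 0]) \<noteq> 0"
    "p_form n (vector [0, 0, 1]) \<noteq> 0"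
  using p_form_powers[OF assms, of 1 0 0] p_form_powers[OF assms, of 0 1 0] p_form_powers[OF assms, of 0 0 1] assms
    unity_root_nonzero[OF assms] finite_unity_roots[OF assms]
  by (auto simp: line_product_def prod_zero_iff power_0_left)

section \<open>The dual curve\<close>

text \<open>The set is given by vectors rather than points, so that vanishing can be checked on the given
  representatives; homogeneity takes care of all others.\<close>

lemma zariski_closure_eq_zero_locus:
  assumes Q: "is_form d Q"
    and sub: "\<And>v. v \<in> A \<Longrightarrow> v \<noteq> 0 \<and> Q v = 0"
    and sup: "\<And>e G v. is_form e G \<Longrightarrow> (\<And>v. v \<in> A \<Longrightarrow> G v = 0) \<Longrightarrow> v \<noteq> 0 \<Longrightarrow> Q v = 0 \<Longrightarrow> G v = 0"
  shows "zariski_closure (point ` A) = zero_locus Q"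
proof -
  have van: "vanishes_on G (point ` A) \<longleftrightarrow> (\<forall>v\<in>A. G v = 0)" if G: "is_form e G" for e G
  proof
    assume *: "\<forall>v\<in>A. G v = 0"
    show "vanishes_on G (point ` A)"
      unfolding vanishes_on_def
    proof (intro allI impI)
      fix v assume v: "v \<noteq> 0 \<and> point v \<in> point ` A"
      then obtain a where a: "a \<in> A" "point a = point v" by auto
      then obtain c where "v = c *s a" using point_eq_iff[of a v] sub v by metis
      then show "G v = 0" using * a form_homogeneous[OF G] by simp
    qed
  qed (use sub in \<open>auto simp: vanishes_on_def\<close>)
  have "(\<forall>d G. is_form d G \<and> vanishes_on G (point ` A) \<longrightarrow> G v = 0) \<longleftrightarrow> Q v = 0" if "v \<noteq> 0" for v
    using van Q sub sup[OF _ _ that] by metis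
  then show ?thesis unfolding zariski_closure_def zero_locus_def by blast
qed

text \<open>The identity principle on the line \<open>a + b + c = 0\<close>, where \<open>a\<close> and \<open>b\<close> serve as coordinates.
  Genericity means avoiding finitely many points, the zeros of the forms \<open>\<alpha> a + \<beta> b\<close>.\<close>

lemma form_vanishes_on_line_if_generically:
  assumes "finite S" "\<And>\<alpha> \<beta>. (\<alpha>, \<beta>) \<in> S \<Longrightarrow> \<alpha> \<noteq> 0 \<or> \<beta> \<noteq> 0"
    and G: "is_form e G"
    and gen: "\<And>a b c. a + b + c = 0 \<Longrightarrow> (\<And>\<alpha> \<beta>. (\<alpha>, \<beta>) \<in> S \<Longrightarrow> \<alpha> * a + \<beta> * b \<noteq> 0) \<Longrightarrow> G (vector [a, b, c]) = 0"
    and abc: "a + b + c = 0"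
  shows "G (vector [a, b, c]) = 0"
proof -
  let ?q = "\<lambda>v :: complex ^ 3. (vector [v $ 1, v $ 2, - 1 * v $ 1 + -1 * v $ 2] :: complex ^ 3)"
  have "G (?q (vector [a, b, 0])) = 0"
  proof (rule form_eq_0_if_generically_0[OF assms(1), where G = "\<lambda>v. G (?q v)" and e = "1 * e"
        and L = "\<lambda>s v. fst s * v $ 1 + snd s * v $ 2" and d = 1])
    show "is_form (1 * e) (\<lambda>v. G (?q v))"
      by (intro is_form_compose G is_form_add is_form_scale is_form_coord)
    fix s assume "s \<in> S"
    show "is_form 1 (\<lambda>v. fst s * v $ 1 + snd s * v $ 2)"
      by (intro is_form_add is_form_scale is_form_coord)
    have "fst s \<noteq> 0 \<or> snd s \<noteq> 0" using assms(2)[of "fst s" "snd s"] \<open>s \<in> S\<close> by simp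
    then show "\<exists>v :: complex ^ 3. fst s * v $ 1 + snd s * v $ 2 \<noteq> 0"
    proof
      assume "fst s \<noteq> 0" then show ?thesis by (intro exI[of _ "vector [1, 0, 0]"]) simp
    next
      assume "snd s \<noteq> 0" then show ?thesis by (intro exI[of _ "vector [0, 1, 0]"]) simp
    qed
  next
    fix v :: "complex ^ 3" assume "\<And>s. s \<in> S \<Longrightarrow> fst s * v $ 1 + snd s * v $ 2 \<noteq> 0"
    then show "G (?q v) = 0" by (intro gen) force+
  qed
  moreover have "- a - b = c" using abc by (simp add: algebra_simps add_eq_0_iff)
  ultimately show ?thesis by simp
qed

text \<open>Write \<open>d = n - 1\<close>. The tangent line at \<open>(a\<^sup>n, b\<^sup>n, c\<^sup>n)\<close> satisfies
  \<open>u a\<^sup>d = v b\<^sup>d = w c\<^sup>d\<close>. If \<open>a b c \<noteq> 0\<close>, its inverse is thus a point of the parametrized curve \<open>X\<^sub>d\<close>;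
  otherwise it is a coordinate axis of the plane, hence one of the coordinate points of the dual plane,
  where the inverted form vanishes as well. In the other direction, every nontrivial zero of the inverted form is proportional to
  \<open>((b c)\<^sup>d, (a c)\<^sup>d, (a b)\<^sup>d)\<close> for some \<open>a + b + c = 0\<close>, and for generic \<open>(a, b, c)\<close> this is a tangent
  line.\<close>

lemma dual_curve_X:
  assumes n: "n \<ge> 2"
  shows "dual_curve (curve_X n) = zero_locus (inverted_form (n - 1) (p_form (n - 1)))"
proof -
  define d where "d = n - 1"
  have d: "d > 0" and n0: "n > 0" using n by (auto simp: d_def)
  note pd = is_form_p_form[OF d]
  let ?Q = "inverted_form d (p_form d)"
  define A where "A = {l. \<exists>v. tangent_line_at (curve_X n) v l}"
  have "zariski_closure (point ` A) = zero_locus ?Q"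
  proof (rule zariski_closure_eq_zero_locus[OF is_form_inverted_form[OF pd]])
    fix l assume "l \<in> A"
    then obtain v where v: "v \<noteq> 0" "point v \<in> curve_X n" and l: "l \<noteq> 0"
      and tan: "tangent_space (curve_X n) v = line_cone l"
      unfolding A_def tangent_line_at_def by blast
    obtain a b c where abc: "a + b + c = 0" and veq: "v = vector [a ^ n, b ^ n, c ^ n]"
      using v mem_curve_X_iff[OF n0] p_form_eq_0_iff[OF n0] by blast
    \<comment> \<open>These two vectors are the velocities of the parametrization, up to the factor \<open>n\<close>.\<close>
    have "vector [a ^ d, - (b ^ d), 0] \<in> tangent_space (curve_X n) v"
      "vector [0, b ^ d, - (c ^ d)] \<in> tangent_space (curve_X n) v"
      unfolding tangent_space_def veq d_def
      using gradient_on_curve_X[OF n0 _ _ abc]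
      by (auto simp: scalar_product_def sum_3)
    then have l12: "l $ 1 * a ^ d = l $ 2 * b ^ d" and l23: "l $ 2 * b ^ d = l $ 3 * c ^ d"
      unfolding tan line_cone_def by (simp_all add: scalar_product_def sum_3)
    obtain l1 l2 l3 where leq: "l = vector [l1, l2, l3]" by (rule vector3_cases)
    have rel: "l1 * a ^ d = l2 * b ^ d" "l2 * b ^ d = l3 * c ^ d" using l12 l23 leq by simp_all
    have nz: "\<not> (a = 0 \<and> b = 0)" "\<not> (a = 0 \<and> c = 0)" "\<not> (b = 0 \<and> c = 0)"
      using v(1) abc n0 unfolding veq vector3_eq_0_iff by (auto simp: power_0_left)
    have "?Q l = 0"
    proof (cases "a = 0 \<or> b = 0 \<or> c = 0")
      case True
      then have "(l2 = 0 \<and> l3 = 0) \<or> (l1 = 0 \<and> l3 = 0) \<or> (l1 = 0 \<and> l2 = 0)"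
        using rel nz d by (auto simp: power_0_left)
      then show ?thesis using d unfolding leq by (auto simp: inverted_form_on_axes[OF pd] power_0_left)
    next
      case False
      define k where "k = l1 * a ^ d"
      have k: "l1 = k / a ^ d" "l2 = k / b ^ d" "l3 = k / c ^ d"
        using rel False by (auto simp: k_def field_simps)
      have "k \<noteq> 0" using l k by (auto simp: leq vector3_eq_0_iff)
      have "p_form d (vector [1 / l1, 1 / l2, 1 / l3]) = p_form d ((1 / k) *s vector [a ^ d, b ^ d, c ^ d])"
        by (simp add: k smult_vector3)
      also have "\<dots> = 0"
        using abc p_form_eq_0_iff[OF d, of "vector [a ^ d, b ^ d, c ^ d]"]
        by (auto simp: form_homogeneous[OF pd])
      finally show ?thesis
        using False \<open>k \<noteq> 0\<close> k unfolding leq by (subst inverted_form_eq[OF pd]) auto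
    qed
    then show "l \<noteq> 0 \<and> ?Q l = 0" using l by simp
  next
    fix e G l assume G: "is_form e G" and van: "\<And>l. l \<in> A \<Longrightarrow> G l = 0" and l: "l \<noteq> 0" and Ql: "?Q l = 0"
    define T where "T = (\<lambda>v :: complex ^ 3. (vector [(v $ 2 * v $ 3) ^ d, (v $ 1 * v $ 3) ^ d, (v $ 1 * v $ 2) ^ d] :: complex ^ 3))"
    \<comment> \<open>On the line, \<open>c + u a + w b = (u - 1) a + (w - 1) b\<close>; the last three pairs exclude \<open>a = 0\<close>, \<open>b = 0\<close> and \<open>c = 0\<close>.\<close>
    let ?R = "unity_roots n \<times> unity_roots n - {(1, 1)}"
    let ?S = "(\<lambda>(u, w). (u - 1, w - 1)) ` ?R \<union> {(1, 0), (0, 1), (1, 1)}"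
    have GT: "G (T (vector [a, b, c])) = 0" if abc: "a + b + c = 0" for a b c
    proof (rule form_vanishes_on_line_if_generically[where S = ?S and e = "(1 + 1) * d * e" and G = "\<lambda>v. G (T v)", OF _ _ _ _ abc])
      show "finite ?S" using finite_unity_roots[OF n0] by simp
      show "is_form ((1 + 1) * d * e) (\<lambda>v. G (T v))"
        unfolding T_def by (intro is_form_compose G is_form_power is_form_mult is_form_coord)
      show "\<alpha> \<noteq> 0 \<or> \<beta> \<noteq> 0" if "(\<alpha>, \<beta>) \<in> ?S" for \<alpha> \<beta> using that by auto
      fix a b c :: complex assume abc: "a + b + c = 0" and gen: "\<And>\<alpha> \<beta>. (\<alpha>, \<beta>) \<in> ?S \<Longrightarrow> \<alpha> * a + \<beta> * b \<noteq> 0"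
      have c: "c = - a - b" using abc by (simp add: algebra_simps add_eq_0_iff)
      have nz: "a \<noteq> 0" "b \<noteq> 0" "c \<noteq> 0" using gen[of 1 0] gen[of 0 1] gen[of 1 1] unfolding c by (auto simp: algebra_simps add_eq_0_iff)
      let ?v = "vector [a ^ n, b ^ n, c ^ n] :: complex ^ 3"
      let ?l = "T (vector [a, b, c])"
      have grad: "gradient H ?v = (gradient H ?v $ 3 * c ^ d / (a * b * c) ^ d) *s ?l"
        if "is_form h H" "vanishes_on H (curve_X n)" for h H
        using gradient_on_curve_X[OF n0 that abc, folded d_def] nz
        by (auto simp: T_def smult_vector3 vec_eq_iff forall_3 field_simps power_mult_distrib)
      have g3: "gradient (p_form n) ?v $ 3 \<noteq> 0"
      proof (rule gradient_p_form_nonzero[OF n0 abc])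
        fix u w assume "(u, w) \<in> ?R"
        then have "(u - 1) * a + (w - 1) * b \<noteq> 0" by (intro gen) force
        then show "c + u * a + w * b \<noteq> 0" unfolding c by (simp add: algebra_simps)
      qed
      have pn: "is_form n (p_form n)" "vanishes_on (p_form n) (curve_X n)"
        using is_form_p_form[OF n0] mem_curve_X_iff[OF n0] by (auto simp: vanishes_on_def)
      have sp: "scalar_product (k *s x) y = k * scalar_product x y" for k and x y :: "complex ^ 3"
        by (simp add: scalar_product_def sum_3 algebra_simps)
      have "tangent_space (curve_X n) ?v = line_cone ?l"
      proof (intro set_eqI iffI)
        fix x assume "x \<in> tangent_space (curve_X n) ?v"
        then have "scalar_product (gradient (p_form n) ?v) x = 0" using pn unfolding tangent_space_def by blast
        then show "x \<in> line_cone ?l"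
          using g3 nz by (subst (asm) grad[OF pn]) (simp add: sp line_cone_def)
      next
        fix x assume x: "x \<in> line_cone ?l"
        have "scalar_product (gradient H ?v) x = 0" if "is_form h H" "vanishes_on H (curve_X n)" for h H
          using x by (subst grad[OF that]) (simp add: sp line_cone_def)
        then show "x \<in> tangent_space (curve_X n) ?v" unfolding tangent_space_def by blast
      qed
      moreover have "?v \<noteq> 0" "?l \<noteq> 0" using nz by (auto simp: T_def vector3_eq_0_iff)
      moreover have "point ?v \<in> curve_X n"
        using mem_curve_X_iff[OF n0 \<open>?v \<noteq> 0\<close>] p_form_eq_0_iff[OF n0] abc by blast
      ultimately have "?l \<in> A" unfolding A_def tangent_line_at_def by blast
      then show "G ?l = 0" by (rule van)
    qed
    obtain u v w where leq: "l = vector [u, v, w]" by (rule vector3_cases)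
    have "\<exists>k a b c. a + b + c = 0 \<and> l = k *s T (vector [a, b, c])"
    proof (cases "u = 0 \<or> v = 0 \<or> w = 0")
      case True
      then have "(v = 0 \<and> w = 0) \<or> (u = 0 \<and> w = 0) \<or> (u = 0 \<and> v = 0)"
        using Ql d p_form_axes_nonzero[OF d] unfolding leq by (auto simp: inverted_form_on_axes[OF pd])
      moreover have sq: "(-1 :: complex) ^ d * (-1) ^ d = 1" by (simp flip: power_mult_distrib)
      ultimately show ?thesis
      proof (elim disjE conjE)
        assume "v = 0" "w = 0"
        then have "l = (u * (-1) ^ d) *s T (vector [0, 1, -1])"
          using d by (simp add: leq T_def smult_vector3 power_0_left mult.assoc sq)
        moreover have "(0 :: complex) + (1) + (-1) = 0" by simp
        ultimately show ?thesis by blast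
      next
        assume "u = 0" "w = 0"
        then have "l = (v * (-1) ^ d) *s T (vector [1, 0, -1])"
          using d by (simp add: leq T_def smult_vector3 power_0_left mult.assoc sq)
        moreover have "(1 :: complex) + (0) + (-1) = 0" by simp
        ultimately show ?thesis by blast
      next
        assume "u = 0" "v = 0"
        then have "l = (w * (-1) ^ d) *s T (vector [1, -1, 0])"
          using d by (simp add: leq T_def smult_vector3 power_0_left mult.assoc sq)
        moreover have "(1 :: complex) + (-1) + (0) = 0" by simp
        ultimately show ?thesis by blast
      qed
    next
      case False
      then have "p_form d (vector [1 / u, 1 / v, 1 / w]) = 0"
        using Ql inverted_form_eq[OF pd, of u v w] unfolding leq by simp
      then obtain a b c where abc: "a + b + c = 0" "a ^ d = 1 / u" "b ^ d = 1 / v" "c ^ d = 1 / w"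
        unfolding p_form_eq_0_iff[OF d] by (auto simp: vector3_eq_iff)
      then have "l = (u * v * w) *s T (vector [a, b, c])"
        using False by (simp add: leq T_def smult_vector3 power_mult_distrib vector3_eq_iff)
      then show ?thesis using abc(1) by blast
    qed
    then show "G l = 0" using GT form_homogeneous[OF G] by auto
  qed
  moreover have "point ` A = {point l | l. \<exists>v. tangent_line_at (curve_X n) v l}" by (auto simp: A_def)
  ultimately show ?thesis unfolding dual_curve_def d_def by simp
qed

text \<open>Away from the coordinate axes, inversion matches the two curves pointwise. The closure
  supplies the points of \<open>X\<^sub>d\<close> on the axes, where one of the parameters \<open>a\<close>, \<open>b\<close>, \<open>c\<close> is zero.\<close>

lemma moebius_image_inverted_form:
  assumes d: "d > 0"
  shows "moebius_image (zero_locus (inverted_form d (p_form d))) = curve_X d"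
proof -
  note pd = is_form_p_form[OF d]
  let ?Q = "inverted_form d (p_form d)"
  define A where "A = {vector [1 / u, 1 / v, 1 / w] :: complex ^ 3 | u v w.
        u \<noteq> 0 \<and> v \<noteq> 0 \<and> w \<noteq> 0 \<and> point (vector [u, v, w]) \<in> zero_locus ?Q}"
  have mem: "point (vector [u, v, w]) \<in> zero_locus ?Q \<longleftrightarrow> p_form d (vector [1 / u, 1 / v, 1 / w]) = 0"
    if "u \<noteq> 0" "v \<noteq> 0" "w \<noteq> 0" for u v w
  proof -
    have "point (vector [u, v, w]) \<in> zero_locus ?Q \<longleftrightarrow> ?Q (vector [u, v, w]) = 0"
      using that by (intro mem_zero_locus_iff[OF is_form_inverted_form[OF pd]]) (simp add: vector3_eq_0_iff)
    then show ?thesis using inverted_form_eq[OF pd that] that by simp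
  qed
  have "zariski_closure (point ` A) = zero_locus (p_form d)"
  proof (rule zariski_closure_eq_zero_locus[OF pd])
    fix x assume "x \<in> A"
    then show "x \<noteq> 0 \<and> p_form d x = 0" unfolding A_def using mem by (auto simp: vector3_eq_0_iff)
  next
    fix e G x assume G: "is_form e G" and van: "\<And>x. x \<in> A \<Longrightarrow> G x = 0" and x: "p_form d x = 0"
    obtain a b c where abc: "a + b + c = 0" and xeq: "x = vector [a ^ d, b ^ d, c ^ d]"
      using x p_form_eq_0_iff[OF d] by blast
    let ?T = "\<lambda>v :: complex ^ 3. (vector [v $ 1 ^ d, v $ 2 ^ d, v $ 3 ^ d] :: complex ^ 3)"
    have "G (?T (vector [a, b, c])) = 0"
    proof (rule form_vanishes_on_line_if_generically[where S = "{(1, 0), (0, 1), (1, 1)}"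
          and e = "1 * d * e" and G = "\<lambda>v. G (?T v)", OF _ _ _ _ abc])
      show "is_form (1 * d * e) (\<lambda>v. G (?T v))"
        by (intro is_form_compose G is_form_power is_form_coord)
      fix a b c :: complex assume abc: "a + b + c = 0"
        and gen: "\<And>\<alpha> \<beta>. (\<alpha>, \<beta>) \<in> {(1, 0), (0, 1), (1, 1)} \<Longrightarrow> \<alpha> * a + \<beta> * b \<noteq> 0"
      have c: "c = - a - b" using abc by (simp add: algebra_simps add_eq_0_iff)
      have nz: "a \<noteq> 0" "b \<noteq> 0" "c \<noteq> 0" using gen[of 1 0] gen[of 0 1] gen[of 1 1] unfolding c by (auto simp: algebra_simps add_eq_0_iff)
      have "p_form d (vector [a ^ d, b ^ d, c ^ d]) = 0" using abc p_form_eq_0_iff[OF d] by blast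
      then have "point (vector [1 / a ^ d, 1 / b ^ d, 1 / c ^ d]) \<in> zero_locus ?Q"
        using mem[of "1 / a ^ d" "1 / b ^ d" "1 / c ^ d"] nz by simp
      then have "vector [a ^ d, b ^ d, c ^ d] \<in> A"
        unfolding A_def using nz
        by (intro CollectI exI[of _ "1 / a ^ d"] exI[of _ "1 / b ^ d"] exI[of _ "1 / c ^ d"]) simp
      then show "G (?T (vector [a, b, c])) = 0" using van by simp
    qed auto
    then show "G x = 0" using xeq by simp
  qed
  moreover have "point ` A = {point (vector [1 / u, 1 / v, 1 / w]) | u v w.
        u \<noteq> 0 \<and> v \<noteq> 0 \<and> w \<noteq> 0 \<and> point (vector [u, v, w]) \<in> zero_locus ?Q}"
    unfolding A_def by blast
  ultimately show ?thesis unfolding moebius_image_def curve_X_def by simp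
qed

section \<open>The shift of monoids\<close>

lemma cleared_scale:
  assumes "is_form d F"
  shows "cleared d (\<lambda>v. k * F v) x y z = k * cleared d F x y z"
proof -
  have "(\<lambda>v. k * F v) = ternary_form d (\<lambda>i j l. k * form_coeff d F i j l)"
    by (subst form_eq_ternary_form_coeff[OF assms])
      (auto simp: fun_eq_iff ternary_form_def sum_distrib_left mult_ac intro!: sum.cong)
  then have "form_coeff d (\<lambda>v. k * F v) i j l = k * form_coeff d F i j l" if "i + j + l = d" for i j l
    using form_coeff_eq[OF _ that] by blast
  then show ?thesis
    unfolding cleared_def sum_distrib_left by (intro sum.cong) (auto simp: mult_ac)
qed

lemma cleared_is_polynomial: "\<exists>p. \<forall>t. poly p t = cleared d F x y (vector [t, 1])"
  unfolding cleared_def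
  by (rule exI[of _ "\<Sum>(i, j, l) \<in> {(i, j, l). i + j + l = d}. smult (form_coeff d F i j l *
     ((x $ 1) ^ i * (x $ 2) ^ (d - i)) * ((y $ 1) ^ j * (y $ 2) ^ (d - j))) (monom 1 l)"])
    (auto simp: poly_sum poly_monom intro!: sum.cong)

lemma binary_zeros_eq:
  assumes "\<And>t. poly p t = B (vector [t, 1])"
  shows "binary_zeros d B = image_mset (\<lambda>t. point (vector [t, 1])) (proots p)
      + replicate_mset (d - degree p) infinity_pt"
proof -
  have "(THE p. \<forall>t. poly p t = B (vector [t, 1])) = p"
  proof (rule the_equality)
    fix q assume "\<forall>t. poly q t = B (vector [t, 1])"
    then have "poly q = poly p" using assms by auto
    then show "q = p" by (simp add: poly_eq_poly_eq_iff)
  qed (use assms in simp)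
  then show ?thesis by (simp add: binary_zeros_def)
qed

lemma binary_zeros_scale:
  assumes p: "\<And>t. poly p t = B (vector [t, 1])" and B': "\<And>t. B' (vector [t, 1]) = k * B (vector [t, 1])"
    and "k \<noteq> 0"
  shows "binary_zeros d B' = binary_zeros d B"
proof -
  have "poly (smult k p) t = B' (vector [t, 1])" for t using p B' by simp
  from binary_zeros_eq[OF this] binary_zeros_eq[OF p] show ?thesis
    using \<open>k \<noteq> 0\<close> by simp
qed

lemma monoid_of_form_scale:
  assumes "is_form d F" "k \<noteq> 0"
  shows "monoid_of_form d (\<lambda>v. k * F v) = monoid_of_form d F"
proof -
  have "binary_zeros d (cleared d (\<lambda>v. k * F v) x y) = binary_zeros d (cleared d F x y)" for x y
  proof -
    obtain p where "\<And>t. poly p t = cleared d F x y (vector [t, 1])" using cleared_is_polynomial by metis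
    then show ?thesis using cleared_scale[OF assms(1)] assms(2) by (rule binary_zeros_scale)
  qed
  then show ?thesis by (simp only: monoid_of_form_def)
qed

lemma finite_point_neq_infinity: "point (vector [t, 1]) \<noteq> infinity_pt"
proof
  have nz: "(vector [t, 1] :: complex ^ 2) \<noteq> 0" "(vector [1, 0] :: complex ^ 2) \<noteq> 0"
    by (auto simp: vec_eq_iff forall_2)
  assume "point (vector [t, 1]) = infinity_pt"
  then show False using point_eq_iff[OF nz] by (auto simp: vec_eq_iff forall_2)
qed

lemma inj_finite_point: "inj (\<lambda>t. point (vector [t, 1]) :: 2 proj)"
proof (rule injI)
  fix s t :: complex
  have nz: "(vector [t, 1] :: complex ^ 2) \<noteq> 0" for t by (auto simp: vec_eq_iff forall_2)
  assume "(point (vector [s, 1]) :: 2 proj) = point (vector [t, 1])"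
  then show "s = t" using point_eq_iff[OF nz nz, of s t] by (auto simp: vec_eq_iff forall_2)
qed

lemma form_in_last_variable:
  assumes "is_form d F"
  obtains p where "\<And>t. poly p t = F (vector [x, y, t])" "degree p \<le> d" "coeff p d = F (vector [0, 0, 1])"
proof
  let ?T = "{(i, j, l). i + j + l = d}"
  define p where "p = (\<Sum>(i, j, l) \<in> ?T. monom (form_coeff d F i j l * x ^ i * y ^ j) l)"
  show "poly p t = F (vector [x, y, t])" for t
    by (subst form_eq_ternary_form_coeff[OF assms])
      (auto simp: p_def ternary_form_def poly_sum poly_monom intro!: sum.cong)
  show "degree p \<le> d"
    unfolding p_def by (rule degree_sum_le[OF finite_exponents]) (auto intro: order.trans[OF degree_monom_le])
  have "coeff p d = (\<Sum>m \<in> {(0, 0, d) :: nat \<times> nat \<times> nat}. form_coeff d F 0 0 d)"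
    unfolding p_def coeff_sum
    by (rule sum.mono_neutral_cong_right[OF finite_exponents]) (auto split: if_splits)
  then show "coeff p d = F (vector [0, 0, 1])" by (simp add: form_coeff_axis[OF assms])
qed

text \<open>The signs \<open>(-1)\<^sup>n\<close> of the arguments cancel those in the multiplication, and the unknown scaling of
  their homogeneous coordinates only contributes a nonzero factor.\<close>

lemma multiplication_of_finite_points:
  assumes F: "is_form n F"
  shows "multiplication (monoid_of_form n F) (point (vector [(-1) ^ n * x, 1])) (point (vector [(-1) ^ n * y, 1]))
    = Some (binary_zeros n (\<lambda>z. F (vector [x, y, z $ 1])))"
proof -
  have nz: "(vector [t, 1] :: complex ^ 2) \<noteq> 0" for t by (auto simp: vec_eq_iff forall_2)
  have sq: "(-1) ^ n * ((-1) ^ n * t) = t" for t :: complex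
    by (simp flip: mult.assoc power_mult_distrib)
  obtain r where r: "r \<noteq> 0" "coords (point (vector [(-1) ^ n * x, 1]) :: 2 proj) = r *s vector [(-1) ^ n * x, 1]"
    using coords_point[OF nz] by blast
  obtain s where s: "s \<noteq> 0" "coords (point (vector [(-1) ^ n * y, 1]) :: 2 proj) = s *s vector [(-1) ^ n * y, 1]"
    using coords_point[OF nz] by blast
  obtain p where p: "\<And>t. poly p t = F (vector [x, y, t])"
    using form_in_last_variable[OF F] by metis
  have "cleared n F (vector [(-1) ^ n * (r * ((-1) ^ n * x)), r]) (vector [(-1) ^ n * (s * ((-1) ^ n * y)), s]) (vector [t, 1])
     = (r * s) ^ n * F (vector [x, y, t])" for t
    using r(1) s(1) by (subst cleared_eq[OF F]) (simp_all add: mult.left_commute[of _ r] mult.left_commute[of _ s] sq)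
  then have "binary_zeros n (cleared n F (vector [(-1) ^ n * (r * ((-1) ^ n * x)), r]) (vector [(-1) ^ n * (s * ((-1) ^ n * y)), s]))
     = binary_zeros n (\<lambda>z. F (vector [x, y, z $ 1]))"
    using p r(1) s(1) by (intro binary_zeros_scale[where p = p and k = "(r * s) ^ n"]) simp_all
  then show ?thesis
    by (simp add: monoid_of_form_def finite_point_neq_infinity r(2) s(2))
qed

text \<open>Fix the first two coordinates. The product of the corresponding finite points consists of \<open>n\<close>
  finite points, because \<open>G\<close> has degree \<open>n\<close> in the last coordinate. Hence infinity does not occur for
  \<open>F\<close> either, which excludes that \<open>F\<close> vanishes identically in the last coordinate (the zero
  polynomial would contribute infinity with multiplicity \<open>n\<close>), and so the two polynomials have the same
  roots.\<close>

lemma zeros_determined_by_monoid: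
  assumes n: "n > 0" and F: "is_form n F" and G: "is_form n G" and lead: "G (vector [0, 0, 1]) \<noteq> 0"
    and eq: "monoid_of_form n F = monoid_of_form n G"
  shows "F v = 0 \<longleftrightarrow> G v = 0"
proof -
  obtain x y z where v: "v = vector [x, y, z]" by (rule vector3_cases)
  obtain p where p: "\<And>t. poly p t = F (vector [x, y, t])" "degree p \<le> n"
    using form_in_last_variable[OF F] by metis
  obtain q where q: "\<And>t. poly q t = G (vector [x, y, t])" "degree q \<le> n" "coeff q n \<noteq> 0"
    using form_in_last_variable[OF G] lead by metis
  have deg: "degree q = n" using q(2,3) by (simp add: le_antisym le_degree)
  let ?f = "\<lambda>t. point (vector [t, 1]) :: 2 proj"
  have "binary_zeros n (\<lambda>z. F (vector [x, y, z $ 1])) = binary_zeros n (\<lambda>z. G (vector [x, y, z $ 1]))"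
    using multiplication_of_finite_points[OF F, of x y] multiplication_of_finite_points[OF G, of x y] eq by simp
  moreover have "binary_zeros n (\<lambda>z. F (vector [x, y, z $ 1])) = image_mset ?f (proots p) + replicate_mset (n - degree p) infinity_pt"
    by (rule binary_zeros_eq) (simp add: p)
  moreover have "binary_zeros n (\<lambda>z. G (vector [x, y, z $ 1])) = image_mset ?f (proots q)"
    by (subst binary_zeros_eq[where p = q]) (simp_all add: q deg)
  ultimately have ms: "image_mset ?f (proots p) + replicate_mset (n - degree p) infinity_pt = image_mset ?f (proots q)"
    by simp
  have "infinity_pt \<notin># image_mset ?f (proots q)"
    by (auto simp: finite_point_neq_infinity[symmetric])
  then have "n - degree p = 0" unfolding ms[symmetric] by (auto simp: in_replicate_mset split: if_splits)
  then have "p \<noteq> 0" "q \<noteq> 0" using n deg by auto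
  moreover have "?f ` set_mset (proots p) = ?f ` set_mset (proots q)"
    using arg_cong[OF ms, of set_mset] \<open>n - degree p = 0\<close> by simp
  then have "set_mset (proots p) = set_mset (proots q)"
    using inj_finite_point by (simp add: inj_image_eq_iff)
  ultimately have "{t. poly p t = 0} = {t. poly q t = 0}" by simp
  then show ?thesis unfolding v p(1)[symmetric] q(1)[symmetric] by blast
qed

text \<open>Each of the two forms divides the other. Comparing degrees, which are read off from the scaling
  by \<open>2\<close> at a point where no form involved vanishes, the quotient is a constant.\<close>

lemma defining_form_unique:
  assumes F: "defining_form d F X" and G: "defining_form e G X" and nz: "F w \<noteq> 0"
  obtains k where "k \<noteq> 0" "e = d" "G = (\<lambda>v. k * F v)"
proof -
  have formF: "is_form d F" and formG: "is_form e G" and XF: "X = zero_locus F" and XG: "X = zero_locus G"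
    using F G by (auto simp: defining_form_def)
  have "vanishes_on F X" "vanishes_on G X"
    using mem_zero_locus_iff[OF formF] mem_zero_locus_iff[OF formG] XF XG by (auto simp: vanishes_on_def)
  then have "\<exists>h H. is_form h H \<and> (\<forall>v. G v = F v * H v)" "\<exists>h H. is_form h H \<and> (\<forall>v. F v = G v * H v)"
    using F G formF formG unfolding defining_form_def by simp_all
  then obtain h H h' H' where H: "is_form h H" "\<And>v. G v = F v * H v"
    and H': "is_form h' H'" "\<And>v. F v = G v * H' v"
    by (elim exE conjE) blast
  have pow2: "a = b" if "(2 :: complex) ^ a = 2 ^ b" for a b
    using arg_cong[OF that, of norm] by (simp add: norm_power)
  have "G w \<noteq> 0" "H' w \<noteq> 0" using nz H'(2)[of w] by auto
  moreover from this have "H w \<noteq> 0" using H(2)[of w] by auto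
  ultimately have nz': "G w \<noteq> 0" "H w \<noteq> 0" "H' w \<noteq> 0" by simp_all
  have "(2 :: complex) ^ e * G w = 2 ^ d * F w * (2 ^ h * H w)"
    using H(2)[of "2 *s w"] by (simp add: form_homogeneous[OF formF] form_homogeneous[OF formG] form_homogeneous[OF H(1)])
  then have "(2 :: complex) ^ e = 2 ^ (d + h)" using nz nz' H(2)[of w] by (simp add: power_add mult_ac)
  then have e: "e = d + h" by (rule pow2)
  have "(2 :: complex) ^ d * F w = 2 ^ e * G w * (2 ^ h' * H' w)"
    using H'(2)[of "2 *s w"] by (simp add: form_homogeneous[OF formF] form_homogeneous[OF formG] form_homogeneous[OF H'(1)])
  then have "(2 :: complex) ^ d = 2 ^ (e + h')" using nz nz' H'(2)[of w] by (simp add: power_add mult_ac)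
  then have d: "d = e + h'" by (rule pow2)
  have "h = 0" using e d by linarith
  then have H0: "H v = H 0" for v using form_homogeneous[OF H(1), of 0 v] by simp
  have "G = (\<lambda>v. H w * F v)"
  proof
    fix v
    have "H v = H w" using H0[of v] H0[of w] by (rule trans[OF _ sym])
    then show "G v = H w * F v" by (simp only: H(2)[of v] mult.commute)
  qed
  then show ?thesis using that[of "H w"] nz'(2) e \<open>h = 0\<close> by simp
qed

theorem theorem10:
  fixes n :: nat
  assumes "n \<ge> 2"
  shows "dual_curve (curve_X n) = zero_locus (inverted_form (n - 1) (p_form (n - 1)))
    \<and> moebius_image (dual_curve (curve_X n)) = curve_X (n - 1)
    \<and> form_shift n (p_form n) (n - 1) (p_form (n - 1))
    \<and> (\<forall>M'. monoid_shift (monoid_M n) M' \<longleftrightarrow> M' = monoid_M (n - 1))"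
proof -
  have n: "n > 0" and m: "n - 1 > 0" using assms by auto
  have dual: "dual_curve (curve_X n) = zero_locus (inverted_form (n - 1) (p_form (n - 1)))"
    by (rule dual_curve_X[OF assms])
  have moebius: "moebius_image (dual_curve (curve_X n)) = curve_X (n - 1)"
    unfolding dual by (rule moebius_image_inverted_form[OF m])
  have shift: "form_shift n (p_form n) (n - 1) (p_form (n - 1))"
    unfolding form_shift_def curve_X_def[symmetric] moebius
    using defining_form_p_form[OF n] defining_form_p_form[OF m] by blast
  have "M' = monoid_M (n - 1)" if M': "monoid_shift (monoid_M n) M'" for M'
  proof -
    obtain d F e G where M: "monoid_M n = monoid_of_form d F" "M' = monoid_of_form e G"
      and FG: "form_shift d F e G" using M' unfolding monoid_shift_def by blast
    have d: "d = n" using arg_cong[OF M(1), of valence] by (simp add: monoid_M_def monoid_of_form_def)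
    have F: "is_form n F" using FG d by (simp add: form_shift_def defining_form_def)
    have "F v = 0 \<longleftrightarrow> p_form n v = 0" for v
      using zeros_determined_by_monoid[OF n F is_form_p_form[OF n] p_form_axes_nonzero(3)[OF n]] M(1) d
      by (simp add: monoid_M_def)
    then have "zero_locus F = curve_X n" by (simp add: curve_X_def zero_locus_def)
    then have "defining_form e G (curve_X (n - 1))" using FG moebius by (simp add: form_shift_def)
    then obtain k where "k \<noteq> 0" "e = n - 1" "G = (\<lambda>v. k * p_form (n - 1) v)"
      using defining_form_unique[OF defining_form_p_form[OF m] _ p_form_axes_nonzero(3)[OF m]] by metis
    then show ?thesis using M(2) monoid_of_form_scale[OF is_form_p_form[OF m]] by (simp add: monoid_M_def)
  qed
  moreover have "monoid_shift (monoid_M n) (monoid_M (n - 1))"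
    unfolding monoid_shift_def monoid_M_def using shift by blast
  ultimately show ?thesis using dual moebius shift by blast
qed

end
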